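(* Let $\Theta^{B}_{3,217}$ denote the $3$-uniform Berge theta hypergraph with $\ell=3$ and $t=217$. Then $\mathrm{ex}^{lin}_{3}(n,\Theta^{B}_{3,217})=\Theta(n^{4/3})$; that is, there are constants $c,C>0$ such that $c\,n^{4/3}\le \mathrm{ex}^{lin}_{3}(n,\Theta^{B}_{3,217})\le C\,n^{4/3}$ for all sufficiently large $n$.
   Context: A $3$-uniform hypergraph is linear if any two distinct hyperedges share at most one vertex. For a $3$-uniform hypergraph $F$, $\mathrm{ex}^{lin}_{3}(n,F)$ is the maximum number of hyperedges in a $3$-uniform linear hypergraph on $n$ vertices that contains no copy of $F$ (as a subhypergraph). The $3$-uniform Berge theta hypergraph $\Theta^{B}_{3,t}$ consists of distinct vertices $x,y,v^{i}_{1},v^{i}_{2}$ ($1\le i\le t$) and distinct hyperedges $e^{i}_{1},e^{i}_{2},e^{i}_{3}$ ($1\le i\le t$) such that $\{x,v^{i}_{1}\}\subseteq e^{i}_{1}$, $\{v^{i}_{1},v^{i}_{2}\}\subseteq e^{i}_{2}$ and $\{v^{i}_{2},y\}\subseteq e^{i}_{3}$ for every $1\le i\le t$. *)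

theory Defs
  imports Complex_Main
begin

type_synonym 'a hypergraph = "'a set \<times> 'a set set"

abbreviation hverts :: "'a hypergraph \<Rightarrow> 'a set" where "hverts \<equiv> fst"
abbreviation hedges :: "'a hypergraph \<Rightarrow> 'a set set" where "hedges \<equiv> snd"

definition uniform3 :: "'a hypergraph \<Rightarrow> bool" where
  "uniform3 H \<longleftrightarrow> finite (hverts H) \<and> (\<forall>e\<in>hedges H. e \<subseteq> hverts H \<and> card e = 3)"

definition linear_hypergraph :: "'a hypergraph \<Rightarrow> bool" where
  "linear_hypergraph H \<longleftrightarrow>
     (\<forall>e\<in>hedges H. \<forall>f\<in>hedges H. e \<noteq> f \<longrightarrow> card (e \<inter> f) \<le> 1)"

definition contains_copy :: "'a hypergraph \<Rightarrow> 'b hypergraph \<Rightarrow> bool" where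
  "contains_copy H F \<longleftrightarrow>
     (\<exists>f. inj_on f (hverts F) \<and> f ` hverts F \<subseteq> hverts H \<and> (\<forall>e\<in>hedges F. f ` e \<in> hedges H))"

text \<open>
  The Berge condition fixes only part of each hyperedge: the remaining vertex of a hyperedge is
  arbitrary and may coincide with a remaining vertex of another hyperedge or with one of the
  vertices \<open>x, y, v i j\<close>. Hence the Berge theta hypergraph is a family of hypergraphs, and to
  avoid it means to avoid every member. The path length is three; \<open>t\<close> is the number of paths.
\<close>

definition berge_theta3 :: "nat \<Rightarrow> nat hypergraph set" where
  "berge_theta3 t = {F. uniform3 F \<and> hverts F = \<Union>(hedges F) \<and>
     (\<exists>x y (v :: nat \<Rightarrow> nat \<Rightarrow> nat) (e :: nat \<Rightarrow> nat \<Rightarrow> nat set).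
        x \<noteq> y \<and>
        inj_on (\<lambda>(i, j). v i j) ({1..t} \<times> {1, 2}) \<and>
        (\<forall>i\<in>{1..t}. \<forall>j\<in>{1, 2}. v i j \<noteq> x \<and> v i j \<noteq> y) \<and>
        inj_on (\<lambda>(i, j). e i j) ({1..t} \<times> {1, 2, 3}) \<and>
        hedges F = (\<lambda>(i, j). e i j) ` ({1..t} \<times> {1, 2, 3}) \<and>
        (\<forall>i\<in>{1..t}. {x, v i 1} \<subseteq> e i 1 \<and> {v i 1, v i 2} \<subseteq> e i 2 \<and> {v i 2, y} \<subseteq> e i 3))}"

text \<open>
  Vertices are taken to be natural numbers without loss of generality, as every finite hypergraph
  is isomorphic to one on natural numbers.
\<close>

definition ex_lin3_sizes :: "nat \<Rightarrow> 'b hypergraph set \<Rightarrow> nat set" where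
  "ex_lin3_sizes n \<F> = {card (hedges H) | H :: nat hypergraph.
     uniform3 H \<and> card (hverts H) = n \<and> linear_hypergraph H \<and>
     (\<forall>F\<in>\<F>. \<not> contains_copy H F)}"

definition ex_lin3 :: "nat \<Rightarrow> 'b hypergraph set \<Rightarrow> nat" where
  "ex_lin3 n \<F> = Max (ex_lin3_sizes n \<F>)"

lemma finite_ex_lin3_sizes: "finite (ex_lin3_sizes n \<F>)"
proof (rule finite_subset)
  show "ex_lin3_sizes n \<F> \<subseteq> {..2 ^ n}"
  proof
    fix m assume "m \<in> ex_lin3_sizes n \<F>"
    then obtain H :: "nat hypergraph" where H: "uniform3 H" "card (hverts H) = n"
      and m: "m = card (hedges H)"
      unfolding ex_lin3_sizes_def by blast
    have fin: "finite (hverts H)" and "hedges H \<subseteq> Pow (hverts H)"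
      using H(1) unfolding uniform3_def by auto
    then have "card (hedges H) \<le> card (Pow (hverts H))"
      by (intro card_mono) auto
    then show "m \<in> {..2 ^ n}" using fin H(2) m by (simp add: card_Pow)
  qed
qed simp

lemma zero_in_ex_lin3_sizes:
  assumes "\<forall>F\<in>\<F>. hedges F \<noteq> {}"
  shows "0 \<in> ex_lin3_sizes n \<F>"
proof -
  let ?H = "({..<n}, {}) :: nat hypergraph"
  have "uniform3 ?H \<and> card (hverts ?H) = n \<and> linear_hypergraph ?H \<and>
        (\<forall>F\<in>\<F>. \<not> contains_copy ?H F)"
    using assms by (auto simp: uniform3_def linear_hypergraph_def contains_copy_def)
  moreover have "0 = card (hedges ?H)" by simp
  ultimately show ?thesis unfolding ex_lin3_sizes_def by blast
qed

lemma berge_theta3_hedges_nonempty: "t \<ge> 1 \<Longrightarrow> F \<in> berge_theta3 t \<Longrightarrow> hedges F \<noteq> {}"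
  unfolding berge_theta3_def by fastforce

end

theory Submission
  imports Defs "Berlekamp_Zassenhaus.Finite_Field" "HOL-Algebra.Algebraic_Closure_Type"
begin

text \<open>
  Upper bound. Choosing one pair of vertices inside every hyperedge of a linear hypergraph yields a
  graph with equally many edges, in which \<open>t\<close> internally disjoint paths of length three between
  two vertices form a Berge theta. If such a graph has minimum degree \<open>d\<close>, then the first three
  levels of a breadth-first search grow by a factor of order \<open>d\<close> each (Faudree and Simonovits):
  a vertex with many neighbours that in turn have many neighbours among the children of one vertex
  \<open>u\<close> is joined to \<open>u\<close> by a theta. Hence \<open>d\<^sup>3 = O(n)\<close>.

  Lower bound. Over a finite field of characteristic 5 take three copies of \<open>K\<^sup>3\<close> as vertex classes.
  Points \<open>(s\<^sub>i, u\<^sub>i, w\<^sub>i)\<close> with \<open>i\<close> ranging over the integers modulo 3 form a hyperedge iff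
  \<open>s\<^sub>0 + s\<^sub>1 + s\<^sub>2 = 0\<close>, \<open>u\<^sub>i - u\<^sub>i\<^sub>+\<^sub>1 = q(s\<^sub>i, s\<^sub>i\<^sub>+\<^sub>1)\<close> and \<open>w\<^sub>i - w\<^sub>i\<^sub>+\<^sub>1 = c(s\<^sub>i, s\<^sub>i\<^sub>+\<^sub>1)\<close>, for symmetric
  forms \<open>q\<close>, \<open>c\<close> of degree 2 and 3 whose cyclic sums vanish on the plane \<open>s\<^sub>0 + s\<^sub>1 + s\<^sub>2 = 0\<close>.
  There are \<open>|K|\<^sup>4\<close> hyperedges. A path of length three between fixed end vertices, running through
  prescribed vertex classes, is determined by the \<open>s\<close>-coordinates of its two inner vertices; these
  satisfy one quadratic and one cubic equation, which have at most 5 nondegenerate common solutions.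
\<close>

section \<open>Graphs without theta subgraphs\<close>

text \<open>The paths are indexed by their last inner vertex \<open>w\<close>, and
  \<open>g w\<close> is the first one, so a theta amounts to a private choice of a common neighbour
  with \<open>x\<close> for every vertex of \<open>T\<close>.\<close>

definition theta_paths :: "('a \<times> 'a) set \<Rightarrow> nat \<Rightarrow> 'a \<Rightarrow> 'a \<Rightarrow> bool" where
  "theta_paths R t x y \<longleftrightarrow> x \<noteq> y \<and>
     (\<exists>T g. finite T \<and> card T = t \<and> inj_on g T \<and> T \<inter> g ` T = {} \<and>
        x \<notin> T \<union> g ` T \<and> y \<notin> T \<union> g ` T \<and>
        (\<forall>w\<in>T. (x, g w) \<in> R \<and> (g w, w) \<in> R \<and> (w, y) \<in> R))"

text \<open>When the elements of \<open>T\<close> are served one after another, fewer than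
  \<open>card T\<close> values are taken at any time.\<close>

lemma greedy_injective_choice:
  assumes "finite T" and "\<And>w. w \<in> T \<Longrightarrow> card T \<le> card (A w)"
  shows "\<exists>g. inj_on g T \<and> (\<forall>w\<in>T. g w \<in> A w)"
  using assms
proof (induction T rule: finite_induct)
  case empty
  then show ?case by simp
next
  case (insert z T)
  have "card T \<le> card (A w)" if "w \<in> T" for w
    using insert.prems[of w] insert.hyps that by simp
  with insert.IH obtain g where g: "inj_on g T" "\<forall>w\<in>T. g w \<in> A w" by blast
  have "card (g ` T) < card (A z)"
    using insert.prems[of z] insert.hyps g(1) by (simp add: card_image)
  then obtain a where a: "a \<in> A z" "a \<notin> g ` T"
    by (meson card_mono finite_imageI insert.hyps(1) not_less subsetI)
  have "inj_on (g(z := a)) (insert z T)"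
    using g(1) a insert.hyps by (auto simp: inj_on_def)
  moreover have "\<forall>w\<in>insert z T. (g(z := a)) w \<in> A w"
    using g(2) a by simp
  ultimately show ?case by blast
qed

section \<open>Degree growth along a breadth-first search\<close>

locale theta_free_graph =
  fixes V :: "'a set" and R :: "('a \<times> 'a) set" and t :: nat
  assumes finite_V: "finite V"
    and R_sub: "R \<subseteq> V \<times> V"
    and sym_R: "sym R"
    and irrefl_R: "(v, v) \<notin> R"
    and theta_free: "\<not> theta_paths R t x y"
begin

abbreviation N :: "'a \<Rightarrow> 'a set" where "N v \<equiv> R `` {v}"

lemma N_sub: "N v \<subseteq> V"
  using R_sub by auto

lemma finite_N [simp]: "finite (N v)"
  using finite_V N_sub finite_subset by blast

lemma R_commute: "(v, w) \<in> R \<longleftrightarrow> (w, v) \<in> R"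
  using sym_R by (auto simp: sym_def)

text \<open>If \<open>t\<close> such neighbours \<open>z\<close> existed, they would be the last
  inner vertices of a theta from \<open>u\<close> to \<open>y\<close>: each has at least
  \<open>2 * t + 1\<close> candidates in \<open>D\<close>, of which \<open>T\<close> and
  \<open>y\<close> block at most \<open>t + 1\<close>, and the remaining \<open>t\<close> suffice
  for the greedy choice.\<close>

lemma heavy_neighbours_few:
  assumes D: "D \<subseteq> N u" and "y \<noteq> u"
  shows "card {z \<in> N y - {u}. 2 * t < card (N z \<inter> D)} < t"
proof (rule ccontr)
  assume "\<not> ?thesis"
  then obtain T where T: "T \<subseteq> {z \<in> N y - {u}. 2 * t < card (N z \<inter> D)}" "card T = t" "finite T"
    by (meson linorder_not_less obtain_subset_with_card_n)
  define A where "A z = N z \<inter> D - insert y T" for z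
  have "card T \<le> card (A z)" if "z \<in> T" for z
  proof -
    have "card (N z \<inter> D) - card (insert y T) \<le> card (A z)"
      unfolding A_def by (rule diff_card_le_card_Diff) (use T in simp)
    moreover have "card (insert y T) \<le> Suc t"
      using T card_insert_le_m1 by (simp add: card_insert_if)
    moreover have "2 * t < card (N z \<inter> D)" using T that by auto
    ultimately show ?thesis using T by linarith
  qed
  with greedy_injective_choice[OF T(3)] obtain g where
    g: "inj_on g T" "\<forall>w\<in>T. g w \<in> A w" by metis
  have "theta_paths R t u y"
    unfolding theta_paths_def
  proof (intro conjI exI[of _ T] exI[of _ g])
    show "u \<noteq> y" using assms by simp
    show "T \<inter> g ` T = {}" using g unfolding A_def by auto
    show "u \<notin> T \<union> g ` T" using T g D irrefl_R unfolding A_def by fastforce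
    show "y \<notin> T \<union> g ` T" using T g irrefl_R unfolding A_def by fastforce
    show "\<forall>w\<in>T. (u, g w) \<in> R \<and> (g w, w) \<in> R \<and> (w, y) \<in> R"
      using T g D R_commute unfolding A_def by blast
  qed (use T g in auto)
  then show False using theta_free by blast
qed

text \<open>For the level sizes \<open>l1\<close> and \<open>l2\<close> around \<open>x\<close>, the
  inequalities \<open>d \<le> l1\<close>, \<open>d * l1 \<le> 4 * t * l2\<close> and
  \<open>d * l2 \<le> 4 * t^2 * n\<close> combine to the claim. The lower bound on \<open>d\<close>
  serves to absorb the other terms of the two edge counts.\<close>

lemma cubic_bound:
  assumes x: "x \<in> V" and deg: "\<And>v. v \<in> V \<Longrightarrow> d \<le> card (N v)"
    and d: "2 * (1 + 6 * t) \<le> d"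
  shows "d ^ 3 \<le> 16 * t ^ 3 * card V"
proof -
  define L1 where "L1 = N x"
  define L2 where "L2 = (\<Union>u\<in>L1. N u) - L1 - {x}"
  have L1V: "L1 \<subseteq> V" and L2V: "L2 \<subseteq> V" using N_sub unfolding L1_def L2_def by auto
  have fin: "finite L1" "finite L2" using L1V L2V finite_V finite_subset by blast+
  have xL1: "x \<notin> L1" using irrefl_R unfolding L1_def by auto
  have disj: "L1 \<inter> L2 = {}" unfolding L2_def by auto
  define par where "par w = (SOME u. u \<in> L1 \<and> (u, w) \<in> R)" for w
  have par: "par w \<in> L1 \<and> (par w, w) \<in> R" if "w \<in> L2" for w
    unfolding par_def by (rule someI_ex) (use that in \<open>auto simp: L2_def\<close>)
  define D where "D u = {w \<in> L2. par w = u}" for u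
  have D_sub: "D u \<subseteq> N u" for u using par unfolding D_def by auto

  \<comment> \<open>Here \<open>x\<close> and \<open>L1\<close> play the roles of \<open>u\<close>
    and \<open>D\<close>. Edges to light neighbours are counted from the light end, where at most
    \<open>2 * t\<close> of them arrive.\<close>
  define heavy1 where "heavy1 y = {z \<in> N y - {x}. 2 * t < card (N z \<inter> L1)}" for y
  define light1 where "light1 y = {z \<in> N y - {x}. card (N z \<inter> L1) \<le> 2 * t}" for y
  have fin1 [simp]: "finite (heavy1 y)" "finite (light1 y)" for y
    unfolding heavy1_def light1_def by (auto intro: finite_subset[OF _ finite_N[of y]])
  have h1: "card (heavy1 y) < t" if "y \<in> L1" for y
    unfolding heavy1_def by (rule heavy_neighbours_few) (use that xL1 in \<open>auto simp: L1_def\<close>)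
  have deg1: "card (N y) \<le> 1 + t + card (light1 y)" if "y \<in> L1" for y
  proof -
    have "N y \<subseteq> {x} \<union> heavy1 y \<union> light1 y" unfolding heavy1_def light1_def by auto
    then have "card (N y) \<le> card ({x} \<union> heavy1 y \<union> light1 y)"
      by (rule card_mono[rotated]) simp
    also have "\<dots> \<le> 1 + card (heavy1 y) + card (light1 y)"
      by (metis (no_types, lifting) add_le_mono1 card_Un_le is_singletonI is_singleton_altdef le_trans)
    finally show ?thesis using h1[OF that] by linarith
  qed
  have light1: "(\<Sum>y\<in>L1. card (light1 y)) \<le> 2 * t * (card L1 + card L2)"
  proof -
    have sub: "light1 y \<subseteq> L1 \<union> L2" if "y \<in> L1" for y
      using that unfolding light1_def L2_def by auto
    have "(\<Sum>y\<in>L1. card (light1 y)) = card (SIGMA y:L1. light1 y)"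
      using fin by simp
    also have "\<dots> \<le> card (SIGMA z:L1 \<union> L2. (if card (N z \<inter> L1) \<le> 2 * t then N z \<inter> L1 else {}))"
    proof (rule card_inj_on_le[where f = prod.swap])
      show "prod.swap ` (SIGMA y:L1. light1 y)
        \<subseteq> (SIGMA z:L1 \<union> L2. (if card (N z \<inter> L1) \<le> 2 * t then N z \<inter> L1 else {}))"
        using sub R_commute unfolding light1_def by fastforce
    qed (use fin in auto)
    also have "\<dots> = (\<Sum>z\<in>L1 \<union> L2. card (if card (N z \<inter> L1) \<le> 2 * t then N z \<inter> L1 else {}))"
      using fin by simp
    also have "\<dots> \<le> (\<Sum>z\<in>L1 \<union> L2. 2 * t)"
    proof (rule sum_mono)
      fix z
      show "card (if card (N z \<inter> L1) \<le> 2 * t then N z \<inter> L1 else {}) \<le> 2 * t"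
        by simp
    qed
    also have "\<dots> = 2 * t * (card L1 + card L2)"
      using fin disj by (simp add: card_Un_disjoint)
    finally show ?thesis .
  qed
  have e1: "(\<Sum>y\<in>L1. card (N y)) \<le> (1 + 3 * t) * card L1 + 2 * t * card L2"
  proof -
    have "(\<Sum>y\<in>L1. card (N y)) \<le> (\<Sum>y\<in>L1. 1 + t + card (light1 y))"
      by (rule sum_mono) (rule deg1)
    also have "\<dots> = (1 + t) * card L1 + (\<Sum>y\<in>L1. card (light1 y))"
      by (simp only: sum.distrib sum_constant) (simp add: algebra_simps)
    finally show ?thesis using light1 by (simp add: algebra_simps)
  qed
  have "d * card L1 \<le> (\<Sum>y\<in>L1. card (N y))"
    using sum_mono[of L1 "\<lambda>_. d" "\<lambda>y. card (N y)"] deg L1V by (auto simp: mult.commute)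
  with e1 have dL1: "d * card L1 \<le> (1 + 3 * t) * card L1 + 2 * t * card L2" by linarith

  define upper where "upper y = N y \<inter> L1" for y
  \<comment> \<open>Now the parent of \<open>y\<close> takes the role of \<open>u\<close>. As
    \<open>y\<close> is itself a child of \<open>par y\<close>, a light neighbour \<open>z\<close>
    sees \<open>y\<close> inside the set \<open>N z \<inter> D (par y)\<close> of size at most
    \<open>2 * t\<close>.\<close>
  define heavy2 where "heavy2 y = {z \<in> N y - {par y}. 2 * t < card (N z \<inter> D (par y))}" for y
  define light2 where "light2 y = {z \<in> N y - L1. card (N z \<inter> D (par y)) \<le> 2 * t}" for y
  have fin2 [simp]: "finite (upper y)" "finite (heavy2 y)" "finite (light2 y)" for y
    unfolding upper_def heavy2_def light2_def by (auto intro: finite_subset[OF _ finite_N[of y]])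
  have h2: "card (heavy2 y) < t" if "y \<in> L2" for y
    unfolding heavy2_def
    by (rule heavy_neighbours_few[OF D_sub]) (use that par irrefl_R in metis)
  have deg2: "card (N y) \<le> card (upper y) + t + card (light2 y)" if "y \<in> L2" for y
  proof -
    have "N y \<subseteq> upper y \<union> heavy2 y \<union> light2 y"
      using par[OF that] unfolding heavy2_def light2_def upper_def by auto
    then have "card (N y) \<le> card (upper y \<union> heavy2 y \<union> light2 y)"
      by (rule card_mono[rotated]) simp
    also have "\<dots> \<le> card (upper y) + card (heavy2 y) + card (light2 y)"
      by (meson add_le_mono1 card_Un_le le_trans)
    finally show ?thesis using h2[OF that] by linarith
  qed
  have upper: "(\<Sum>y\<in>L2. card (upper y)) \<le> (1 + 3 * t) * card L1 + 2 * t * card L2"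
  proof -
    have "(\<Sum>y\<in>L2. card (upper y)) = card (SIGMA y:L2. upper y)"
      using fin by simp
    also have "\<dots> \<le> card (SIGMA z:L1. N z)"
    proof (rule card_inj_on_le[where f = prod.swap])
      show "prod.swap ` (SIGMA y:L2. upper y) \<subseteq> (SIGMA z:L1. N z)"
        using R_commute unfolding upper_def by fastforce
    qed (use fin in auto)
    also have "\<dots> = (\<Sum>z\<in>L1. card (N z))" using fin by simp
    finally show ?thesis using e1 by linarith
  qed
  \<comment> \<open>One child for each of \<open>t\<close> distinct parents would give a theta from
    \<open>x\<close> to \<open>z\<close>, with \<open>par\<close> choosing the first inner
    vertices.\<close>
  have parents_few: "card (par ` (N z \<inter> L2)) < t" if z: "z \<noteq> x" "z \<notin> L1" for z
  proof (rule ccontr)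
    assume "\<not> ?thesis"
    then obtain P where P: "P \<subseteq> par ` (N z \<inter> L2)" "card P = t" "finite P"
      by (meson linorder_not_less obtain_subset_with_card_n)
    obtain T where T: "T \<subseteq> N z \<inter> L2" "inj_on par T" "P = par ` T"
      using P(1) by (meson subset_image_inj)
    have "theta_paths R t x z"
      unfolding theta_paths_def
    proof (intro conjI exI[of _ T] exI[of _ par])
      show "x \<noteq> z" using z by simp
      show "finite T" "card T = t" using T P by (auto simp: card_image dest: finite_imageD)
      have parT: "par ` T \<subseteq> L1" using T par by blast
      show "T \<inter> par ` T = {}" using parT T disj by blast
      show "x \<notin> T \<union> par ` T" using parT T xL1 unfolding L2_def by blast
      show "z \<notin> T \<union> par ` T" using parT T z irrefl_R by blast
      show "\<forall>w\<in>T. (x, par w) \<in> R \<and> (par w, w) \<in> R \<and> (w, z) \<in> R"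
        using T par R_commute unfolding L1_def by blast
    qed (rule T(2))
    then show False using theta_free by blast
  qed
  \<comment> \<open>Each \<open>z\<close> meets children of fewer than \<open>t\<close> parents, and
    at most \<open>2 * t\<close> children of each parent that counts.\<close>
  have light2: "(\<Sum>y\<in>L2. card (light2 y)) \<le> 2 * t\<^sup>2 * card V"
  proof -
    define M where "M z = (\<Union>u\<in>{u \<in> par ` (N z \<inter> L2). card (N z \<inter> D u) \<le> 2 * t}. N z \<inter> D u)" for z
    have finM: "finite (M z)" for z unfolding M_def using fin by auto
    have cardM: "card (M z) \<le> 2 * t\<^sup>2" if z: "z \<noteq> x" "z \<notin> L1" for z
    proof -
      let ?U = "{u \<in> par ` (N z \<inter> L2). card (N z \<inter> D u) \<le> 2 * t}"
      have "card (M z) \<le> (\<Sum>u\<in>?U. card (N z \<inter> D u))"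
        unfolding M_def by (rule card_UN_le) (use fin in auto)
      also have "\<dots> \<le> (\<Sum>u\<in>?U. 2 * t)" by (rule sum_mono) auto
      also have "\<dots> = 2 * t * card ?U" by simp
      also have "\<dots> \<le> 2 * t * card (par ` (N z \<inter> L2))"
        by (intro mult_le_mono2 card_mono) (use fin in auto)
      also have "\<dots> \<le> 2 * t * t" using parents_few[OF z] by (intro mult_le_mono2) simp
      finally show ?thesis by (simp add: power2_eq_square)
    qed
    have xN: "x \<notin> N y" if "y \<in> L2" for y
      using that R_commute unfolding L2_def L1_def by auto
    have "(\<Sum>y\<in>L2. card (light2 y)) = card (SIGMA y:L2. light2 y)"
      using fin by simp
    also have "\<dots> \<le> card (SIGMA z:V - L1 - {x}. M z)"
    proof (rule card_inj_on_le[where f = prod.swap])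
      show "prod.swap ` (SIGMA y:L2. light2 y) \<subseteq> (SIGMA z:V - L1 - {x}. M z)"
      proof clarsimp
        fix y z assume yz: "y \<in> L2" "z \<in> light2 y"
        then have "z \<in> N y" "z \<notin> L1" "card (N z \<inter> D (par y)) \<le> 2 * t"
          unfolding light2_def by auto
        moreover have "y \<in> N z" using \<open>z \<in> N y\<close> R_commute by auto
        moreover have "y \<in> D (par y)" using yz unfolding D_def by auto
        moreover have "z \<noteq> x" using xN yz \<open>z \<in> N y\<close> by blast
        ultimately show "z \<in> V \<and> z \<notin> L1 \<and> z \<noteq> x \<and> y \<in> M z"
          using N_sub yz unfolding M_def by blast
      qed
    qed (use finite_V finM in auto)
    also have "\<dots> = (\<Sum>z\<in>V - L1 - {x}. card (M z))" using finite_V finM by simp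
    also have "\<dots> \<le> (\<Sum>z\<in>V - L1 - {x}. 2 * t\<^sup>2)" by (rule sum_mono) (use cardM in auto)
    also have "\<dots> = 2 * t\<^sup>2 * card (V - L1 - {x})" by simp
    also have "\<dots> \<le> 2 * t\<^sup>2 * card V"
      by (intro mult_le_mono2 card_mono) (use finite_V in auto)
    finally show ?thesis .
  qed
  have dL2: "d * card L2 \<le> (1 + 3 * t) * card L1 + 3 * t * card L2 + 2 * t\<^sup>2 * card V"
  proof -
    have "d * card L2 \<le> (\<Sum>y\<in>L2. card (N y))"
      using sum_mono[of L2 "\<lambda>_. d" "\<lambda>y. card (N y)"] deg L2V by (auto simp: mult.commute)
    also have "\<dots> \<le> (\<Sum>y\<in>L2. card (upper y) + t + card (light2 y))"
      by (rule sum_mono) (rule deg2)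
    also have "\<dots> = (\<Sum>y\<in>L2. card (upper y)) + t * card L2 + (\<Sum>y\<in>L2. card (light2 y))"
      by (simp only: sum.distrib sum_constant) (simp add: algebra_simps)
    finally show ?thesis using upper light2 by (simp add: algebra_simps)
  qed

  define l1 l2 n where "l1 = card L1" and "l2 = card L2" and "n = card V"
  have dl1: "d \<le> l1" using deg[OF x] by (simp add: l1_def L1_def)
  have A: "d * l1 \<le> 4 * t * l2"
  proof -
    have "2 * (1 + 3 * t) * l1 \<le> d * l1" using d by (intro mult_le_mono1) simp
    then show ?thesis using dL1 unfolding l1_def l2_def by (simp add: algebra_simps)
  qed
  have l12: "l1 \<le> l2"
  \<comment> \<open>For \<open>t = 0\<close> the factor \<open>4 * t\<close> cannot be cancelled,
    but then \<open>A\<close> already forces \<open>l1 = 0\<close>.\<close>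
  proof (cases "t = 0")
    case True
    then show ?thesis using A d by simp
  next
    case False
    have "4 * t * l1 \<le> d * l1" using d by (intro mult_le_mono1) simp
    then have "4 * t * l1 \<le> 4 * t * l2" using A by linarith
    then show ?thesis using False by simp
  qed
  have B: "d * l2 \<le> 4 * t\<^sup>2 * n"
  proof -
    have "2 * (1 + 6 * t) * l2 \<le> d * l2" using d by (intro mult_le_mono1) simp
    moreover have "(1 + 3 * t) * l1 \<le> (1 + 3 * t) * l2" using l12 by (rule mult_le_mono2)
    ultimately show ?thesis using dL2 unfolding l1_def l2_def n_def
      by (simp add: algebra_simps)
  qed
  have "d ^ 3 = d * (d * d)" by (simp add: power3_eq_cube)
  also have "\<dots> \<le> d * (d * l1)" using dl1 by simp
  also have "\<dots> \<le> d * (4 * t * l2)" using A by (rule mult_le_mono2)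
  also have "\<dots> = 4 * t * (d * l2)" by simp
  also have "\<dots> \<le> 4 * t * (4 * t\<^sup>2 * n)" using B by (rule mult_le_mono2)
  also have "\<dots> = 16 * t ^ 3 * n" by (simp add: power2_eq_square power3_eq_cube)
  finally show ?thesis by (simp add: n_def)
qed

end

text \<open>Vertices of degree below \<open>d\<close> are deleted one at a time. As \<open>R\<close>
  holds both orientations of every edge, a deletion removes fewer than \<open>2 * d\<close> pairs,
  so \<open>2 * d * card V \<le> card R\<close> persists. A single vertex cannot satisfy it, since
  an irreflexive \<open>R\<close> is empty there.\<close>

lemma min_degree_subgraph:
  assumes "finite V" "V \<noteq> {}" "R \<subseteq> V \<times> V" "sym R" "irrefl R"
    and "2 * d * card V \<le> card R" "0 < d"
  shows "\<exists>S\<subseteq>V. S \<noteq> {} \<and> (\<forall>v\<in>S. d \<le> card (R `` {v} \<inter> S))"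
  using assms
proof (induction V arbitrary: R rule: finite_psubset_induct)
  case (psubset V)
  show ?case
  proof (cases "\<forall>v\<in>V. d \<le> card (R `` {v} \<inter> V)")
    case True
    then show ?thesis using psubset.prems by blast
  next
    case False
    then obtain v where v: "v \<in> V" "card (R `` {v} \<inter> V) < d" by force
    let ?V = "V - {v}"
    let ?R = "R \<inter> ?V \<times> ?V"
    have RV: "R `` {v} \<inter> V = R `` {v}" using psubset.prems by auto
    have fin: "finite R" using psubset by (meson finite_SigmaI finite_subset)
    have finN: "finite (R `` {v})" using RV psubset.hyps by (metis finite_Int)
    have "R \<subseteq> ?R \<union> Pair v ` (R `` {v}) \<union> (\<lambda>w. (w, v)) ` (R `` {v})"
      using psubset.prems by (auto simp: image_iff sym_def)
    then have "card R \<le> card (?R \<union> Pair v ` (R `` {v}) \<union> (\<lambda>w. (w, v)) ` (R `` {v}))"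
      using fin finN by (intro card_mono) auto
    also have "\<dots> \<le> card ?R + card (Pair v ` (R `` {v})) + card ((\<lambda>w. (w, v)) ` (R `` {v}))"
      by (meson add_le_mono1 card_Un_le le_trans)
    also have "\<dots> \<le> card ?R + card (R `` {v}) + card (R `` {v})"
      by (intro add_mono card_image_le finN) simp
    finally have le: "card R \<le> card ?R + 2 * card (R `` {v})" by simp
    have cV: "card V = Suc (card ?V)"
      using v psubset.hyps by (metis card_Suc_Diff1)
    have le': "2 * d * card ?V \<le> card ?R"
    proof -
      have "2 * d * card V = 2 * d * card ?V + 2 * d" unfolding cV by simp
      moreover have "card (R `` {v}) < d" using v(2) unfolding RV .
      ultimately show ?thesis using le psubset.prems(5) by linarith
    qed
    have ne: "?V \<noteq> {}"
    proof
      assume "?V = {}"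
      then have "R \<subseteq> {v} \<times> {v}" using psubset.prems(2) by auto
      then have "R = {}" using psubset.prems(4) by (auto simp: irrefl_def)
      then show False using psubset.prems v psubset.hyps by (auto simp: card_gt_0_iff)
    qed
    have "\<exists>S\<subseteq>?V. S \<noteq> {} \<and> (\<forall>v\<in>S. d \<le> card (?R `` {v} \<inter> S))"
    proof (rule psubset.IH)
      show "sym ?R" using psubset.prems(3) by (auto simp: sym_def)
      show "irrefl ?R" using psubset.prems(4) by (auto simp: irrefl_def)
    qed (use v ne le' psubset.prems in auto)
    then obtain S where S: "S \<subseteq> ?V" "S \<noteq> {}" "\<forall>v\<in>S. d \<le> card (?R `` {v} \<inter> S)" by blast
    have "?R `` {w} \<inter> S = R `` {w} \<inter> S" if "w \<in> S" for w using S(1) that by auto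
    with S show ?thesis by (metis Diff_subset subset_trans)
  qed
qed

section \<open>Edge count of theta-free graphs\<close>

lemma theta_paths_mono: "theta_paths R t x y \<Longrightarrow> R \<subseteq> R' \<Longrightarrow> theta_paths R' t x y"
  unfolding theta_paths_def by blast

lemma (in theta_free_graph) card_edges_le:
  "real (card R) \<le> (4 + 36 * real t) * real (card V) powr (4 / 3)"
proof (cases "V = {}")
  case True
  then show ?thesis using R_sub by simp
next
  case False
  define n where "n = card V"
  have n: "1 \<le> n" using False finite_V by (simp add: n_def Suc_le_eq card_gt_0_iff)
  have n43: "real n powr (4 / 3) = real n * real n powr (1 / 3)"
    using n powr_add[of "real n" 1 "1 / 3"] by simp
  have n13: "1 \<le> real n powr (1 / 3)" using n by (simp add: ge_one_powr_ge_zero)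
  \<comment> \<open>Half the average degree, rounded down: the minimum degree that a subgraph is
    guaranteed to reach.\<close>
  define d where "d = card R div (2 * n)"
  have m: "card R < 2 * n * (d + 1)"
    unfolding d_def using n dividend_less_times_div[of "2 * n" "card R"] by simp
  have m': "2 * d * n \<le> card R" unfolding d_def
    by (metis mult.assoc mult.commute times_div_less_eq_dividend)
  have dle: "real (d + 1) \<le> (2 + 18 * real t) * real n powr (1 / 3)"
  proof (cases "2 * (1 + 6 * t) \<le> d")
    case False
    then have "real (d + 1) \<le> real (2 * (1 + 6 * t))" by (simp only: of_nat_le_iff)
    also have "\<dots> \<le> (2 + 18 * real t) * 1" by simp
    also have "\<dots> \<le> (2 + 18 * real t) * real n powr (1 / 3)"
      using n13 by (intro mult_left_mono) auto
    finally show ?thesis .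
  next
    case True
    have irr: "irrefl R" using irrefl_R by (auto simp: irrefl_def)
    obtain S where S: "S \<subseteq> V" "S \<noteq> {}" "\<forall>v\<in>S. d \<le> card (R `` {v} \<inter> S)"
      using min_degree_subgraph[OF finite_V \<open>V \<noteq> {}\<close> R_sub sym_R irr, of d] m' True
      by (auto simp: n_def)
    interpret S: theta_free_graph S "R \<inter> S \<times> S" t
    proof
      show "finite S" using S finite_V finite_subset by blast
      show "sym (R \<inter> S \<times> S)" using sym_R by (auto simp: sym_def)
      show "(v, v) \<notin> R \<inter> S \<times> S" for v using irrefl_R by blast
      show "\<not> theta_paths (R \<inter> S \<times> S) t x y" for x y
        using theta_free theta_paths_mono by (metis inf_le1)
    qed auto
    obtain x where x: "x \<in> S" using S by blast
    have "d \<le> card ((R \<inter> S \<times> S) `` {v})" if "v \<in> S" for v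
    proof -
      have "(R \<inter> S \<times> S) `` {v} = R `` {v} \<inter> S" using that by auto
      then show ?thesis using S that by metis
    qed
    then have "d ^ 3 \<le> 16 * t ^ 3 * card S" using S.cubic_bound[OF x] True by blast
    also have "\<dots> \<le> 16 * t ^ 3 * n"
      using S finite_V by (auto simp: n_def intro: card_mono)
    finally have "real (d ^ 3) \<le> real (16 * t ^ 3 * n)" by (simp only: of_nat_le_iff)
    then have "real d ^ 3 \<le> 16 * real t ^ 3 * real n" by simp
    \<comment> \<open>Replacing 16 by the cube 27 gives an explicit cube root.\<close>
    also have "\<dots> \<le> 27 * real t ^ 3 * real n" by (intro mult_right_mono) auto
    also have "\<dots> = (3 * real t * real n powr (1 / 3)) ^ 3"
      using n by (simp add: power_mult_distrib powr_power)
    finally have "real d \<le> 3 * real t * real n powr (1 / 3)"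
      by (subst (asm) power_mono_iff) auto
    moreover have "1 \<le> real d" using True by simp
    ultimately have "real (d + 1) \<le> 6 * real t * real n powr (1 / 3)" by simp
    also have "\<dots> \<le> (2 + 18 * real t) * real n powr (1 / 3)"
      by (intro mult_right_mono) auto
    finally show ?thesis .
  qed
  have "real (card R) \<le> real (2 * n * (d + 1))" using m by (simp only: of_nat_le_iff)
  also have "\<dots> = 2 * real n * real (d + 1)" by (simp only: of_nat_mult of_nat_numeral)
  also have "\<dots> \<le> 2 * real n * ((2 + 18 * real t) * real n powr (1 / 3))"
    using dle by (intro mult_left_mono) auto
  also have "\<dots> = (4 + 36 * real t) * real n powr (4 / 3)"
    using n43 by (simp add: algebra_simps)
  finally show ?thesis by (simp add: n_def)
qed

section \<open>From theta-free graphs to linear hypergraphs\<close>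

lemma linear_hypergraph_edge_unique:
  assumes "uniform3 H" "linear_hypergraph H" "e \<in> hedges H" "f \<in> hedges H"
    "u \<in> e" "w \<in> e" "u \<in> f" "w \<in> f" "u \<noteq> w"
  shows "e = f"
proof (rule ccontr)
  assume "e \<noteq> f"
  then have "card (e \<inter> f) \<le> 1" using assms unfolding linear_hypergraph_def by blast
  moreover have "finite e" using assms unfolding uniform3_def by (metis finite_subset)
  then have "card {u, w} \<le> card (e \<inter> f)" using assms by (intro card_mono) auto
  ultimately show False using assms by simp
qed

lemma berge_theta3I:
  fixes v :: "nat \<Rightarrow> nat \<Rightarrow> nat" and e :: "nat \<Rightarrow> nat \<Rightarrow> nat set"
  assumes "uniform3 F" "hverts F = \<Union>(hedges F)" "x \<noteq> y"
    "inj_on (\<lambda>(i, j). v i j) ({1..t} \<times> {1, 2})"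
    "\<forall>i\<in>{1..t}. \<forall>j\<in>{1, 2}. v i j \<noteq> x \<and> v i j \<noteq> y"
    "inj_on (\<lambda>(i, j). e i j) ({1..t} \<times> {1, 2, 3})"
    "hedges F = (\<lambda>(i, j). e i j) ` ({1..t} \<times> {1, 2, 3})"
    "\<forall>i\<in>{1..t}. {x, v i 1} \<subseteq> e i 1 \<and> {v i 1, v i 2} \<subseteq> e i 2 \<and> {v i 2, y} \<subseteq> e i 3"
  shows "F \<in> berge_theta3 t"
  unfolding berge_theta3_def mem_Collect_eq
  by (intro conjI assms, rule exI[of _ x], rule exI[of _ y], rule exI[of _ v], rule exI[of _ e],
      intro conjI assms)

text \<open>The map \<open>q\<close> recovers from a hyperedge the pair it stands for, so the
  \<open>3 * t\<close> distinct pairs along the paths give distinct hyperedges. Coincidences among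
  third vertices are allowed by the Berge condition, and the copy is embedded by the
  identity.\<close>

lemma berge_theta3_of_theta_paths:
  fixes H :: "nat hypergraph"
  assumes H: "uniform3 H" and th: "theta_paths R t x y"
    and ed: "\<And>u w. (u, w) \<in> R \<Longrightarrow> ed u w \<in> hedges H \<and> {u, w} \<subseteq> ed u w \<and> q (ed u w) = {u, w}"
  shows "\<exists>F\<in>berge_theta3 t. contains_copy H F"
proof -
  obtain T g where T: "x \<noteq> y" "finite T" "card T = t" "inj_on g T" "T \<inter> g ` T = {}"
    "x \<notin> T \<union> g ` T" "y \<notin> T \<union> g ` T"
    "\<forall>w\<in>T. (x, g w) \<in> R \<and> (g w, w) \<in> R \<and> (w, y) \<in> R"
    using th unfolding theta_paths_def by blast
  obtain h where h: "bij_betw h {1..t} T"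
    using ex_bij_betw_nat_finite_1[OF T(2)] T(3) by blast
  have hT: "h i \<in> T" if "i \<in> {1..t}" for i using bij_betwE[OF h] that by blast
  have hinj: "h i = h k \<longleftrightarrow> i = k" if "i \<in> {1..t}" "k \<in> {1..t}" for i k
    using inj_on_eq_iff[OF bij_betw_imp_inj_on[OF h] that] .
  define v where "v i j = (if j = 1 then g (h i) else h i)" for i j :: nat
  define e where "e i j = (if j = 1 then ed x (g (h i)) else if j = 2 then ed (g (h i)) (h i)
    else ed (h i) y)" for i j :: nat
  define Es where "Es = (\<lambda>(i, j). e i j) ` ({1..t} \<times> {1, 2, 3})"
  define F where "F = (\<Union> Es, Es)"
  have eR: "(x, g (h i)) \<in> R" "(g (h i), h i) \<in> R" "(h i, y) \<in> R" if "i \<in> {1..t}" for i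
    using T(8) hT[OF that] by auto
  have Es: "Es \<subseteq> hedges H" unfolding Es_def e_def using ed eR by auto
  have ginj: "g (h i) = g (h k) \<longleftrightarrow> i = k" if "i \<in> {1..t}" "k \<in> {1..t}" for i k
    using T(4) hT hinj that by (metis inj_onD)
  have ne: "g (h i) \<noteq> h k" "g (h i) \<noteq> x" "g (h i) \<noteq> y" "h i \<noteq> x" "h i \<noteq> y"
    if "i \<in> {1..t}" "k \<in> {1..t}" for i k
    using T(5-7) hT[OF that(1)] hT[OF that(2)] imageI[OF hT[OF that(1)], of g]
    unfolding Un_iff disjoint_iff by metis+
  have einj: "inj_on (\<lambda>(i, j). e i j) ({1..t} \<times> {1, 2, 3})"
  proof -
    have "inj_on (q \<circ> (\<lambda>(i, j). e i j)) ({1..t} \<times> {1, 2, 3})"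
    proof (rule inj_onI, clarify)
      fix i j k l assume ik: "i \<in> {1..t}" "k \<in> {1..t}" and jl: "j \<in> {1, 2, 3}" "l \<in> {1, 2, 3}"
        and "(q \<circ> (\<lambda>(i, j). e i j)) (i, j) = (q \<circ> (\<lambda>(i, j). e i j)) (k, l)"
      then have eq: "q (e i j) = q (e k l)" by simp
      have q: "q (e i 1) = {x, g (h i)}" "q (e i 2) = {g (h i), h i}" "q (e i 3) = {h i, y}"
        if "i \<in> {1..t}" for i
        using ed eR[OF that] by (auto simp: e_def)
      show "i = k \<and> j = l"
        using jl eq q[OF ik(1)] q[OF ik(2)] ne[OF ik] ne[OF ik(2,1)] ginj[OF ik] hinj[OF ik] T(1)
        by (elim insertE emptyE) (auto simp: doubleton_eq_iff)
    qed
    then show ?thesis by (rule inj_on_imageI2)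
  qed
  have "F \<in> berge_theta3 t"
  proof (rule berge_theta3I[OF _ _ T(1) _ _ einj])
    show "uniform3 F"
      using H Es unfolding uniform3_def F_def
      by (auto simp: Sup_upper intro: finite_subset[of "\<Union> Es" "hverts H"])
    show "hedges F = (\<lambda>(i, j). e i j) ` ({1..t} \<times> {1, 2, 3})" by (simp add: F_def Es_def)
    show "inj_on (\<lambda>(i, j). v i j) ({1..t} \<times> {1, 2})"
    proof (rule inj_onI)
      fix p r :: "nat \<times> nat"
      assume pr: "p \<in> {1..t} \<times> {1, 2}" "r \<in> {1..t} \<times> {1, 2}"
        and eq: "(case p of (i, j) \<Rightarrow> v i j) = (case r of (i, j) \<Rightarrow> v i j)"
      obtain i j k l where p: "p = (i, j)" and r: "r = (k, l)" by (metis surj_pair)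
      have ik: "i \<in> {1..t}" "k \<in> {1..t}" and jl: "j \<in> {1, 2}" "l \<in> {1, 2}"
        using pr by (simp_all add: p r)
      show "p = r"
        using jl eq ne[OF ik] ne[OF ik(2,1)] ginj[OF ik] hinj[OF ik] unfolding p r
        by (elim insertE emptyE) (auto simp: v_def)
    qed
    show "\<forall>i\<in>{1..t}. \<forall>j\<in>{1, 2}. v i j \<noteq> x \<and> v i j \<noteq> y" using ne by (auto simp: v_def)
    show "\<forall>i\<in>{1..t}. {x, v i 1} \<subseteq> e i 1 \<and> {v i 1, v i 2} \<subseteq> e i 2 \<and> {v i 2, y} \<subseteq> e i 3"
      using ed eR by (auto simp: v_def e_def)
  qed (simp add: F_def)
  moreover have "contains_copy H F"
    unfolding contains_copy_def
    using Es H by (intro exI[of _ id]) (auto simp: F_def uniform3_def)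
  ultimately show ?thesis by blast
qed

lemma card_hedges_le:
  fixes H :: "nat hypergraph"
  assumes H: "uniform3 H" "linear_hypergraph H"
    and free: "\<forall>F\<in>berge_theta3 t. \<not> contains_copy H F"
  shows "real (card (hedges H)) \<le> (4 + 36 * real t) * real (card (hverts H)) powr (4 / 3)"
proof -
  have "\<exists>u w. u \<in> e \<and> w \<in> e \<and> u \<noteq> w" if "e \<in> hedges H" for e
  proof -
    have "card e = 3" using H that by (auto simp: uniform3_def)
    then show ?thesis by (auto simp: card_3_iff)
  qed
  then obtain a b where ab: "\<And>e. e \<in> hedges H \<Longrightarrow> a e \<in> e \<and> b e \<in> e \<and> a e \<noteq> b e" by metis
  define R where "R = (\<Union>e\<in>hedges H. {(a e, b e), (b e, a e)})"
  have "\<exists>e. e \<in> hedges H \<and> {u, w} \<subseteq> e \<and> {a e, b e} = {u, w}" if "(u, w) \<in> R" for u w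
    using that ab unfolding R_def by auto
  then obtain ed where ed: "\<And>u w. (u, w) \<in> R \<Longrightarrow> ed u w \<in> hedges H \<and> {u, w} \<subseteq> ed u w \<and>
    {a (ed u w), b (ed u w)} = {u, w}" by metis
  have sub: "e \<subseteq> hverts H" if "e \<in> hedges H" for e using H that by (auto simp: uniform3_def)
  have finH: "finite (hverts H)" using H by (simp add: uniform3_def)
  interpret theta_free_graph "hverts H" R t
  proof
    show "R \<subseteq> hverts H \<times> hverts H" using ab sub unfolding R_def by blast
    show "sym R" unfolding R_def by (auto simp: sym_def)
    show "(v, v) \<notin> R" for v using ab unfolding R_def by force
    show "\<not> theta_paths R t x y" for x y
      using berge_theta3_of_theta_paths[where q = "\<lambda>e. {a e, b e}", OF H(1) _ ed] free by blast
  qed (rule finH)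
  \<comment> \<open>Linearity enters here: hyperedges with the same chosen pair share two
    vertices.\<close>
  have "inj_on (\<lambda>e. (a e, b e)) (hedges H)"
  proof (rule inj_onI)
    fix e f assume "e \<in> hedges H" "f \<in> hedges H" "(a e, b e) = (a f, b f)"
    then show "e = f" using linear_hypergraph_edge_unique[OF H, of e f "a e" "b e"] ab
      by (metis prod.inject)
  qed
  then have "card (hedges H) \<le> card R"
  proof (rule card_inj_on_le)
    show "finite R" using R_sub finH by (meson finite_SigmaI finite_subset)
  qed (auto simp: R_def)
  then show ?thesis using card_edges_le by linarith
qed

lemma ex_lin3_berge_theta3_le:
  assumes "1 \<le> t"
  shows "real (ex_lin3 n (berge_theta3 t)) \<le> (4 + 36 * real t) * real n powr (4 / 3)"
proof -
  \<comment> \<open>The maximum is attained since the edgeless hypergraph provides a size.\<close>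
  have "ex_lin3 n (berge_theta3 t) \<in> ex_lin3_sizes n (berge_theta3 t)"
    unfolding ex_lin3_def
    using zero_in_ex_lin3_sizes berge_theta3_hedges_nonempty[OF assms]
    by (intro Max_in finite_ex_lin3_sizes) blast
  then obtain H :: "nat hypergraph" where "uniform3 H" "card (hverts H) = n" "linear_hypergraph H"
    "\<forall>F\<in>berge_theta3 t. \<not> contains_copy H F" "ex_lin3 n (berge_theta3 t) = card (hedges H)"
    unfolding ex_lin3_sizes_def by auto
  then show ?thesis using card_hedges_le[of H t] by simp
qed

section \<open>Finite fields of characteristic five\<close>

hide_const (open) Divisibility.prime

text \<open>The fixed points are the roots of \<open>X^q - X\<close> with \<open>q = p^k\<close>.
  This polynomial splits into \<open>q\<close> linear factors, and none repeats because its
  derivative is the constant \<open>- 1\<close>.\<close>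

lemma card_frobenius_fixed_points:
  fixes p k :: nat
  assumes "prime p" "CHAR('a::alg_closed_field) = p" "0 < k"
  shows "card {x::'a. x ^ (p ^ k) = x} = p ^ k"
proof -
  let ?q = "p ^ k"
  define P :: "'a poly" where "P = monom 1 ?q - monom 1 1"
  have q: "1 < ?q" using assms(1,3) prime_gt_1_nat one_less_power by blast
  have degP: "Polynomial.degree P = ?q"
    unfolding P_def using q using degree_add_eq_left[of "- monom 1 1" "monom (1::'a) ?q"]
    by (simp add: degree_monom_eq)
  then have "P \<noteq> 0" using q by (metis Polynomial.degree_0 not_one_less_zero)
  then obtain A where A: "size A = ?q"
    "P = Polynomial.smult (Polynomial.lead_coeff P) (\<Prod>x\<in>#A. [:- x, 1:])"
    using alg_closed_imp_factorization[of P] degP by auto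
  have lc: "Polynomial.lead_coeff P = 1" unfolding degP using q by (simp add: P_def)
  have roots: "poly P x = 0 \<longleftrightarrow> x \<in># A" for x
    by (subst A(2)) (auto simp: lc poly_prod_mset image_iff prod_mset_zero_iff)
  have pderiv: "pderiv P = - 1"
  proof -
    have "(of_nat ?q :: 'a) = 0" using assms by (simp add: of_nat_eq_0_iff_char_dvd)
    then show ?thesis by (simp add: P_def pderiv_diff pderiv_monom one_poly_eq_simps flip: monom_0)
  qed
  have double_root: "poly (pderiv P) x = 0" if "2 \<le> count A x" for x
  proof -
    have "replicate_mset 2 x \<subseteq># A" using that by (simp add: count_le_replicate_mset_subset_eq)
    then obtain B where "A = replicate_mset 2 x + B" by (metis subset_mset.add_diff_inverse)
    then have "P = [:- x, 1:] * ([:- x, 1:] * (\<Prod>x\<in>#B. [:- x, 1:]))"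
      using A(2) lc by (simp add: numeral_2_eq_2 mult.assoc)
    then show ?thesis by (simp add: pderiv_mult del: mult_pCons_left)
  qed
  have "count A x \<le> 1" for x
  proof (rule ccontr)
    assume "\<not> count A x \<le> 1"
    then have "poly (pderiv P) x = 0" by (intro double_root) simp
    then show False unfolding pderiv by simp
  qed
  then have "count A x = 1" if "x \<in># A" for x
    using that by (meson count_greater_eq_one_iff le_antisym)
  then have "size A = card (set_mset A)"
    by (simp add: size_multiset_overloaded_eq)
  moreover have "{x. x ^ ?q = x} = set_mset A"
    using roots by (auto simp: P_def poly_monom)
  ultimately show ?thesis using A(1) by simp
qed

typedef five = "{0..<5::nat}" by (rule exI[of _ 0]) simp

lemma card_five: "CARD(five) = 5"
  using type_definition.card[OF type_definition_five] by simp

instance five :: prime_card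
  by standard (simp add: card_five)

text \<open>This closure contains fields of every order \<open>5^k\<close>. The order depends on
  \<open>n\<close> and so cannot be built into a type; the fields appear below as subsets
  \<open>K\<close> of this one type.\<close>

type_synonym gf5_closure = "five mod_ring alg_closure"

lemma CHAR_gf5_closure: "CHAR(gf5_closure) = 5"
  by (simp add: card_five)

lemma gf5_closure_numerals: "(2 :: gf5_closure) \<noteq> 0" "(3 :: gf5_closure) \<noteq> 0"
  using of_nat_eq_0_iff_char_dvd[of 2, where 'a = gf5_closure]
    of_nat_eq_0_iff_char_dvd[of 3, where 'a = gf5_closure]
  by (simp_all add: card_five)

text \<open>The fixed points of the \<open>k\<close>-fold Frobenius map are closed under sums
  because the map is additive, and under negation because \<open>5^k\<close> is odd.\<close>

lemma finite_subring_gf5_closure: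
  assumes "0 < k"
  obtains K :: "gf5_closure set" where "card K = 5 ^ k" "1 \<in> K"
    "\<And>x y. x \<in> K \<Longrightarrow> y \<in> K \<Longrightarrow> x + y \<in> K" "\<And>x. x \<in> K \<Longrightarrow> - x \<in> K"
    "\<And>x y. x \<in> K \<Longrightarrow> y \<in> K \<Longrightarrow> x * y \<in> K"
proof
  let ?K = "{x :: gf5_closure. x ^ (5 ^ k) = x}"
  have five: "prime (5::nat)" by simp
  show "card ?K = 5 ^ k"
    using card_frobenius_fixed_points[OF five CHAR_gf5_closure assms] .
  show "x + y \<in> ?K" if "x \<in> ?K" "y \<in> ?K" for x y
    using that freshmans_dream'[of "5 ^ k" k x y] by (simp add: card_five)
  show "- x \<in> ?K" if "x \<in> ?K" for x
    using that by (simp add: power_minus_odd)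
qed (auto simp: power_mult_distrib)

section \<open>A dense theta-free linear hypergraph\<close>

text \<open>The cyclic sum \<open>qform a b + qform b c + qform c a\<close> equals
  \<open>2 * (a + b + c)^2\<close>.\<close>

definition qform :: "'a::comm_ring_1 \<Rightarrow> 'a \<Rightarrow> 'a" where
  "qform a b = a^2 + 4 * a * b + b^2"

text \<open>The cyclic sum equals \<open>2 * (a + b + c) * (a^2 + b^2 + c^2)\<close>.\<close>

definition cform :: "'a::comm_ring_1 \<Rightarrow> 'a \<Rightarrow> 'a" where
  "cform a b = a^3 + 2 * a^2 * b + 2 * a * b^2 + b^3"

text \<open>The solution counts below rest on this: \<open>h\<close> projects solutions injectively
  to roots of an eliminant \<open>P\<close>.\<close>

lemma card_le_degree_if_roots:
  fixes P :: "'a::idom poly"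
  assumes "P \<noteq> 0" "inj_on h S" "\<And>z. z \<in> S \<Longrightarrow> poly P (h z) = 0"
  shows "finite S \<and> card S \<le> Polynomial.degree P"
proof -
  have sub: "h ` S \<subseteq> {x. poly P x = 0}" using assms by auto
  have fin: "finite {x. poly P x = 0}" using assms(1) by (rule poly_roots_finite)
  have "finite S" using sub fin assms(2) by (meson finite_imageD finite_subset)
  moreover have "card S = card (h ` S)" using assms(2) by (simp add: card_image)
  moreover have "card (h ` S) \<le> card {x. poly P x = 0}" using sub fin by (rule card_mono[rotated])
  ultimately show ?thesis using card_poly_roots_bound[OF assms(1)] by linarith
qed

section \<open>Solution counts for the sign patterns of a path\<close>

context
  fixes a d k1 k2 :: "'a::field"
  assumes two: "(2::'a) \<noteq> 0" and three: "(3::'a) \<noteq> 0"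
begin

lemma four_neq_0: "(4::'a) \<noteq> 0"
  using two by (metis mult_eq_0_iff numeral_Bit0_eq_double)

lemma eight_neq_0: "(8::'a) \<noteq> 0"
  using four_neq_0 by (metis mult_eq_0_iff numeral_Bit0_eq_double two)

lemma twelve_neq_0: "(12::'a) \<noteq> 0"
proof -
  have "(12::'a) = 4 * 3" by simp
  then show ?thesis using four_neq_0 three by (metis mult_eq_0_iff)
qed

text \<open>With \<open>s = b + c\<close> the equations read \<open>2 * (a + s)^2 = k1\<close> and
  \<open>2 * (a + s) * (a^2 + b^2 + c^2) = k2\<close>. The first has at most two solutions
  \<open>s\<close>. For each, the second is quadratic in \<open>b\<close>, with leading coefficient
  \<open>4 * (a + s)\<close>, nonzero by the condition \<open>a + b + c \<noteq> 0\<close>.\<close>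

lemma card_cyclic_paths_same:
  defines "S \<equiv> {(b, c). qform a b + qform b c + qform c a = k1 \<and>
    cform a b + cform b c + cform c a = k2 \<and>
    a + b + c \<noteq> 0}"
  shows "finite S \<and> card S \<le> 5"
proof -
  define U where "U = {s. poly [:2 * a^2 - k1, 4 * a, 2:] s = 0 \<and> a + s \<noteq> 0}"
  define Q where "Q s = [:2 * a^3 + 2 * s^3 + 2 * a^2 * s + 2 * a * s^2 - k2,
    - 4 * (a + s) * s, 4 * (a + s):]" for s
  define W where "W s = {(b, c). b + c = s \<and> poly (Q s) b = 0}" for s
  have U: "finite U \<and> card U \<le> 2"
    using card_le_degree_if_roots[of "[:2 * a^2 - k1, 4 * a, 2:]" id U] two
    by (simp add: U_def)
  have W: "finite (W s) \<and> card (W s) \<le> 2" if "s \<in> U" for s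
  proof -
    have "4 * (a + s) \<noteq> 0" using that four_neq_0 unfolding U_def mult_eq_0_iff by blast
    then have "Q s \<noteq> 0" "Polynomial.degree (Q s) = 2" unfolding Q_def by simp_all
    moreover have "inj_on fst (W s)"
      by (rule inj_onI) (auto simp: W_def)
    moreover have "poly (Q s) (fst z) = 0" if "z \<in> W s" for z
      using that by (auto simp: W_def)
    ultimately show ?thesis using card_le_degree_if_roots[of "Q s" fst "W s"] by metis
  qed
  have "S \<subseteq> (\<Union>s\<in>U. W s)"
  proof clarify
    fix b c assume "(b, c) \<in> S"
    then have eq: "qform a b + qform b c + qform c a = k1" "cform a b + cform b c + cform c a = k2"
      and ne: "a + (b + c) \<noteq> 0" by (auto simp: S_def algebra_simps)
    have "b + c \<in> U"
      using ne unfolding U_def qform_def eq(1)[symmetric]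
      by (simp add: algebra_simps power2_eq_square)
    moreover have "(b, c) \<in> W (b + c)"
      unfolding W_def Q_def cform_def eq(2)[symmetric]
      by (simp add: algebra_simps power2_eq_square power3_eq_cube)
    ultimately show "(b, c) \<in> (\<Union>s\<in>U. W s)" by blast
  qed
  moreover have "finite (\<Union>s\<in>U. W s)" using U W by blast
  moreover have "card (\<Union>s\<in>U. W s) \<le> 4"
  proof -
    have "card (\<Union>s\<in>U. W s) \<le> (\<Sum>s\<in>U. card (W s))" using U by (intro card_UN_le) blast
    also have "\<dots> \<le> (\<Sum>s\<in>U. 2)" using W by (intro sum_mono) blast
    finally show ?thesis using U by simp
  qed
  ultimately show ?thesis by (meson card_mono finite_subset le_trans numeral_le_iff semiring_norm)
qed

lemma card_cyclic_paths_different: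
  assumes "a \<noteq> d"
  defines "S \<equiv> {(b, c). qform a b + qform b c + qform c d = k1 \<and>
    cform a b + cform b c + cform c d = k2}"
  shows "finite S \<and> card S \<le> 5"
proof -
  define \<delta> where "\<delta> = d - a"
  define \<kappa> where "\<kappa> = k1 - a^2 - d^2"
  define B C :: "'a poly" where "B = [:- \<kappa>, 4 * d, 2:]" and "C = [:\<kappa>, - 4 * a, - 2:]"
  \<comment> \<open>With \<open>s = b + c\<close>, the quadratic equation reads \<open>4 \<delta> c = C(s)\<close>, \<open>4 \<delta> b = B(s)\<close>; substituting this
    into the cubic equation and clearing denominators gives \<open>P(s) = 0\<close>.\<close>
  define P where "P = [:8 * \<delta>^2 * (a^3 + d^3 - k2), 0, 0, 16 * \<delta>^2:] - [:0, 2:] * B * C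
    + smult (4 * \<delta> * a^2) B + smult (4 * \<delta> * d^2) C + smult a (B * B) + smult d (C * C)"
  \<comment> \<open>Only \<open>- [:0, 2:] * B * C\<close> reaches degree 5; it contributes
    \<open>- 2 * 2 * (- 2)\<close>.\<close>
  have "Polynomial.coeff P 5 = 8"
    by (simp add: P_def B_def C_def numeral_eq_Suc)
  then have "P \<noteq> 0" using eight_neq_0 by auto
  moreover have "Polynomial.degree P \<le> 5"
    by (simp add: P_def B_def C_def)
  moreover have root: "4 * \<delta> * c = poly C (b + c) \<and> poly P (b + c) = 0" if "(b, c) \<in> S" for b c
  proof -
    have e1: "k1 = qform a b + qform b c + qform c d" and e2: "k2 = cform a b + cform b c + cform c d"
      using that by (auto simp: S_def)
    have C: "poly C (b + c) = 4 * \<delta> * c"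
      by (simp add: C_def \<kappa>_def \<delta>_def e1 qform_def algebra_simps power2_eq_square)
    have B: "poly B (b + c) = 4 * \<delta> * b"
      by (simp add: B_def \<kappa>_def \<delta>_def e1 qform_def algebra_simps power2_eq_square)
    have "poly P (b + c) = 0"
      by (simp add: P_def B C e2 cform_def algebra_simps power2_eq_square power3_eq_cube)
    then show ?thesis using C by simp
  qed
  moreover have "inj_on (\<lambda>(b, c). b + c) S"
  proof (rule inj_onI, clarify)
    fix b c b' c' assume "(b, c) \<in> S" "(b', c') \<in> S" and eq: "b + c = b' + c'"
    then have "4 * \<delta> * c = 4 * \<delta> * c'" using root by metis
    then have "c = c'" using four_neq_0 assms by (simp add: \<delta>_def)
    then show "b = b' \<and> c = c'" using eq by simp
  qed
  ultimately show ?thesis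
    using card_le_degree_if_roots[of P "\<lambda>(b, c). b + c" S] by fastforce
qed

lemma card_turning_paths:
  defines "S \<equiv> {(b, c). qform a b + qform b c - qform c d = k1 \<and>
    cform a b + cform b c - cform c d = k2 \<and> b \<noteq> d}"
  shows "finite S \<and> card S \<le> 4"
proof -
  define \<kappa> where "\<kappa> = k1 - a^2 + d^2"
  define M :: "'a poly" where "M = [:\<kappa>, - 4 * a, - 2:]"
  \<comment> \<open>The quadratic equation reads \<open>4 (b - d) c = M(b)\<close>; eliminating \<open>c\<close> gives \<open>P(b) = 0\<close>.\<close>
  define P where "P = [:- d, 1:] * [:8 * (a^3 - d^3 - k2), 16 * a^2, 16 * a, 16:]
    + [:- 4 * d^2, 0, 4:] * M + M * M"
  \<comment> \<open>The three summands contribute \<open>16 - 8 + 4\<close>; this is where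
    characteristic 3 is excluded.\<close>
  have "Polynomial.coeff P 4 = 12"
    by (simp add: P_def M_def numeral_eq_Suc)
  then have "P \<noteq> 0" using twelve_neq_0 by auto
  moreover have "Polynomial.degree P \<le> 4"
    by (simp add: P_def M_def)
  moreover have root: "4 * (b - d) * c = poly M b \<and> poly P b = 0" if "(b, c) \<in> S" for b c
  proof -
    have e1: "k1 = qform a b + qform b c - qform c d" and e2: "k2 = cform a b + cform b c - cform c d"
      using that by (auto simp: S_def)
    have M: "poly M b = 4 * (b - d) * c"
      by (simp add: M_def \<kappa>_def e1 qform_def algebra_simps power2_eq_square)
    have "poly P b = 0"
      by (simp add: P_def M e2 cform_def algebra_simps power2_eq_square power3_eq_cube)
    then show ?thesis using M by simp
  qed
  moreover have "inj_on fst S"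
  proof (rule inj_onI, clarify)
    fix b c b' c' assume S: "(b, c) \<in> S" "(b', c') \<in> S" and "fst (b, c) = fst (b', c')"
    then have b: "b = b'" by simp
    then have "4 * (b - d) * c = 4 * (b - d) * c'" using root S by metis
    then show "b = b' \<and> c = c'" using four_neq_0 S b by (auto simp: S_def)
  qed
  ultimately show ?thesis
    using card_le_degree_if_roots[of P fst S] by fastforce
qed

text \<open>The equations factor as \<open>m1 = 4 * (b - d) * (c - a)\<close> and
  \<open>m2 = 2 * (b - d) * (c - a) * (a + b + c + d)\<close>. Their quotient determines
  \<open>b + c\<close>, after which the first one is quadratic in \<open>b\<close>.\<close>

lemma card_alternating_paths:
  defines "S \<equiv> {(b, c). - qform a b + qform b c - qform c d = k1 \<and>
    - cform a b + cform b c - cform c d = k2 \<and>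
    a \<noteq> c \<and> b \<noteq> d}"
  shows "finite S \<and> card S \<le> 2"
proof -
  define m1 m2 where "m1 = k1 + a^2 + d^2 + 4 * a * d"
    and "m2 = k2 + a^3 + d^3 + 2 * a^2 * d + 2 * a * d^2"
  \<comment> \<open>If \<open>m1 = 0\<close>, the quotient takes the default value 0, but then
    \<open>S\<close> is empty.\<close>
  define s where "s = 2 * m2 / m1 - a - d"
  define P where "P = [:- 4 * d * (s - a) - m1, 4 * (s - a + d), - 4:]"
  have root: "c = s - b \<and> poly P b = 0" if "(b, c) \<in> S" for b c
  proof -
    have e1: "k1 = - qform a b + qform b c - qform c d" and e2: "k2 = - cform a b + cform b c - cform c d"
      and ne: "a \<noteq> c" "b \<noteq> d"
      using that by (auto simp: S_def)
    have m1: "m1 = 4 * (b - d) * (c - a)"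
      by (simp add: m1_def e1 qform_def algebra_simps power2_eq_square)
    have m2: "m2 = 2 * (b - d) * (c - a) * (a + b + c + d)"
      by (simp add: m2_def e2 cform_def algebra_simps power2_eq_square power3_eq_cube)
    have "m1 \<noteq> 0" using m1 ne four_neq_0 by simp
    moreover have "2 * m2 = m1 * (a + b + c + d)" by (simp add: m1 m2)
    ultimately have c: "c = s - b" by (simp add: s_def field_simps)
    have "poly P b = 0" by (simp add: P_def m1 c algebra_simps power2_eq_square)
    then show ?thesis using c by simp
  qed
  have "inj_on fst S"
    by (rule inj_onI) (metis root prod.collapse)
  moreover have "P \<noteq> 0" "Polynomial.degree P = 2" using four_neq_0 by (simp_all add: P_def)
  ultimately show ?thesis
    using card_le_degree_if_roots[of P fst S] root by fastforce
qed

end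

lemma qform_commute: "qform a b = qform b a" and cform_commute: "cform a b = cform b a"
  by (simp_all add: qform_def cform_def algebra_simps)

text \<open>Multiplication by \<open>\<sigma>2\<close> makes the middle sign positive. Equal
  neighbouring signs mean that the path goes on in the same cyclic direction, opposite ones that it
  turns back. A turn at the first inner vertex becomes one at the second when the path is
  reversed.\<close>

lemma card_paths_le:
  fixes a d k1 k2 \<sigma>1 \<sigma>2 \<sigma>3 :: "'a::field"
  assumes two: "(2::'a) \<noteq> 0" and three: "(3::'a) \<noteq> 0"
    and \<sigma>: "\<sigma>1 \<in> {1, -1}" "\<sigma>2 \<in> {1, -1}" "\<sigma>3 \<in> {1, -1}"
  defines "S \<equiv> {(b, c). \<sigma>1 * qform a b + \<sigma>2 * qform b c + \<sigma>3 * qform c d = k1 \<and>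
      \<sigma>1 * cform a b + \<sigma>2 * cform b c + \<sigma>3 * cform c d = k2 \<and>
      (\<sigma>1 = \<sigma>2 \<longrightarrow> a + b + c \<noteq> 0) \<and> (\<sigma>1 \<noteq> \<sigma>2 \<longrightarrow> a \<noteq> c) \<and> (\<sigma>2 \<noteq> \<sigma>3 \<longrightarrow> b \<noteq> d)}"
  shows "finite S \<and> card S \<le> 5"
proof -
  have pm: "(1::'a) \<noteq> - 1" using two by (metis one_add_one add.right_inverse)
  have sq: "\<sigma>2 * \<sigma>2 = 1" using \<sigma> by auto
  define l1 l2 where "l1 = \<sigma>2 * k1" and "l2 = \<sigma>2 * k2"
  have S: "S = {(b, c). (\<sigma>2 * \<sigma>1) * qform a b + qform b c + (\<sigma>2 * \<sigma>3) * qform c d = l1 \<and>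
      (\<sigma>2 * \<sigma>1) * cform a b + cform b c + (\<sigma>2 * \<sigma>3) * cform c d = l2 \<and>
      (\<sigma>1 = \<sigma>2 \<longrightarrow> a + b + c \<noteq> 0) \<and> (\<sigma>1 \<noteq> \<sigma>2 \<longrightarrow> a \<noteq> c) \<and> (\<sigma>2 \<noteq> \<sigma>3 \<longrightarrow> b \<noteq> d)}"
  proof -
    have "\<sigma>1 * f + \<sigma>2 * g + \<sigma>3 * h = k \<longleftrightarrow>
        (\<sigma>2 * \<sigma>1) * f + g + (\<sigma>2 * \<sigma>3) * h = \<sigma>2 * k" for f g h k
    proof -
      have "(\<sigma>2 * \<sigma>1) * f + g + (\<sigma>2 * \<sigma>3) * h = \<sigma>2 * (\<sigma>1 * f + \<sigma>2 * g + \<sigma>3 * h)"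
        using sq by (simp add: distrib_left flip: mult.assoc)
      moreover have "\<sigma>2 \<noteq> 0" using sq by auto
      ultimately show ?thesis by (metis mult_left_cancel)
    qed
    then show ?thesis unfolding S_def l1_def l2_def by presburger
  qed
  consider "\<sigma>1 = \<sigma>2" "\<sigma>3 = \<sigma>2" "a = d" | "\<sigma>1 = \<sigma>2" "\<sigma>3 = \<sigma>2" "a \<noteq> d" | "\<sigma>1 = \<sigma>2" "\<sigma>3 = - \<sigma>2"
    | "\<sigma>1 = - \<sigma>2" "\<sigma>3 = \<sigma>2" | "\<sigma>1 = - \<sigma>2" "\<sigma>3 = - \<sigma>2"
    using \<sigma> by (elim insertE emptyE) auto
  then show ?thesis
  proof cases
    case 1
    show ?thesis
      using card_cyclic_paths_same[OF two three, of d l1 l2] unfolding S 1 sq by simp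
  next
    case 2
    have "S \<subseteq> {(b, c). qform a b + qform b c + qform c d = l1 \<and>
      cform a b + cform b c + cform c d = l2}"
      unfolding S 2 sq by auto
    then show ?thesis
      using card_cyclic_paths_different[OF two three 2(3), of l1 l2] by (meson card_mono finite_subset le_trans)
  next
    case 3
    have "S \<subseteq> {(b, c). qform a b + qform b c - qform c d = l1 \<and>
      cform a b + cform b c - cform c d = l2 \<and> b \<noteq> d}"
      (is "_ \<subseteq> ?T")
      unfolding S 3 using sq pm \<sigma>(2) by auto
    moreover have "finite ?T \<and> card ?T \<le> 4"
      using card_turning_paths[OF two three, of a d l1 l2] .
    ultimately have "finite S \<and> card S \<le> 4" by (meson card_mono finite_subset le_trans)
    then show ?thesis by simp
  next
    case 4
    let ?T = "{(b, c). qform d b + qform b c - qform c a = l1 \<and>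
      cform d b + cform b c - cform c a = l2 \<and> b \<noteq> a}"
    have "S \<subseteq> prod.swap ` ?T"
    proof clarify
      fix b c assume "(b, c) \<in> S"
      then have "(c, b) \<in> ?T"
        unfolding S 4 using sq pm \<sigma>(2) by (auto simp: qform_commute cform_commute algebra_simps)
      then show "(b, c) \<in> prod.swap ` ?T" by force
    qed
    moreover have "finite ?T \<and> card ?T \<le> 4"
      using card_turning_paths[OF two three, of d a l1 l2] .
    ultimately have "finite S \<and> card S \<le> 4"
      by (meson card_image_le card_mono finite_imageI finite_subset le_trans)
    then show ?thesis by simp
  next
    case 5
    have "S \<subseteq> {(b, c). - qform a b + qform b c - qform c d = l1 \<and>
      - cform a b + cform b c - cform c d = l2 \<and>
      a \<noteq> c \<and> b \<noteq> d}" (is "_ \<subseteq> ?T")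
      unfolding S 5 using sq pm \<sigma>(2) by auto
    moreover have "finite ?T \<and> card ?T \<le> 2"
      using card_alternating_paths[OF two three, of a d l1 l2] .
    ultimately have "finite S \<and> card S \<le> 2" by (meson card_mono finite_subset le_trans)
    then show ?thesis by simp
  qed
qed

section \<open>Hyperedges, adjacency and the number of paths\<close>

type_synonym 'a vertex = "nat \<times> 'a \<times> 'a \<times> 'a"

text \<open>The sign of a step in the cyclic order of the classes. For distinct classes the default
  \<open>- 1\<close> is the reversed step, so that with symmetric forms one equation describes
  adjacency from both ends.\<close>

definition orient :: "nat \<Rightarrow> nat \<Rightarrow> 'a::field" where
  "orient i j = (if j = (i + 1) mod 3 then 1 else - 1)"

definition adj :: "'a::field vertex \<Rightarrow> 'a vertex \<Rightarrow> bool" where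
  "adj = (\<lambda>(i, s, u, w) (j, s', u', w'). i < 3 \<and> j < 3 \<and> i \<noteq> j \<and>
     u - u' = orient i j * qform s s' \<and> w - w' = orient i j * cform s s')"

text \<open>The steps from class 0 to 1 and from class 2 to 0 are built in. The step from 1 to 2
  follows because the cyclic sums vanish.\<close>

definition triple :: "'a::field \<Rightarrow> 'a \<Rightarrow> 'a \<Rightarrow> 'a \<Rightarrow> 'a vertex set" where
  "triple a b u w = {(0, a, u, w), (1, b, u - qform a b, w - cform a b),
     (2, - a - b, u + qform (- a - b) a, w + cform (- a - b) a)}"

lemma adj_iff: "adj (i, s, u, w) (j, s', u', w') \<longleftrightarrow> i < 3 \<and> j < 3 \<and> i \<noteq> j \<and>
     u - u' = orient i j * qform s s' \<and> w - w' = orient i j * cform s s'"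
  by (simp add: adj_def)

lemma less_3_cases: "(i::nat) < 3 \<Longrightarrow> i = 0 \<or> i = 1 \<or> i = 2"
  by linarith

lemma orient_in: "orient i j \<in> {1, - 1}"
  by (simp add: orient_def)

lemma orient_swap:
  assumes "i < 3" "j < 3" "i \<noteq> j"
  shows "orient j i = - orient i j"
  using less_3_cases[OF assms(1)] less_3_cases[OF assms(2)] assms(3)
  by (elim disjE) (simp_all add: orient_def)

lemma orient_turn:
  assumes "(2::'a::field) \<noteq> 0" "i < 3" "j < 3" "k < 3" "i \<noteq> j" "j \<noteq> k"
  shows "(orient i j :: 'a) = orient j k \<longleftrightarrow> k \<noteq> i"
proof -
  have "(1::'a) \<noteq> - 1" using assms(1) by (metis one_add_one add.right_inverse)
  then show ?thesis
    using less_3_cases[OF assms(2)] less_3_cases[OF assms(3)] less_3_cases[OF assms(4)] assms(5,6)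
    by (elim disjE) (auto simp: orient_def)
qed

lemma qform_cyclic: "qform b (- a - b) = - qform a b - qform (- a - b) a"
  by (simp add: qform_def algebra_simps power2_eq_square)

lemma cform_cyclic: "cform b (- a - b) = - cform a b - cform (- a - b) a"
  by (simp add: cform_def algebra_simps power2_eq_square power3_eq_cube)

lemma triple_adj:
  assumes "P \<in> triple a b u w" "Q \<in> triple a b u w" "P \<noteq> Q"
  shows "adj P Q"
proof -
  have "qform (- a - b) b = - qform a b - qform (- a - b) a" "cform (- a - b) b = - cform a b - cform (- a - b) a"
    using qform_cyclic[of b a] cform_cyclic[of b a] by (simp_all only: qform_commute cform_commute)
  then show ?thesis
    using assms unfolding triple_def
    by (elim insertE emptyE)
      (simp_all add: adj_iff orient_def qform_cyclic cform_cyclic qform_commute[of b a] cform_commute[of b a]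
        qform_commute[of a "- a - b"] cform_commute[of a "- a - b"])
qed

lemma triple_mem_cases:
  assumes "(i, s, p) \<in> triple a b u w"
  shows "i = 0 \<and> s = a \<or> i = 1 \<and> s = b \<or> i = 2 \<and> s = - (a + b)"
  using assms by (auto simp: triple_def)

text \<open>A hyperedge has one vertex in each class, so two common vertices give two of the
  \<open>s\<close>-coordinates, and the zero sum gives the third; then \<open>u\<close> and
  \<open>w\<close> can be read off from \<open>P\<close>.\<close>

lemma triple_unique:
  assumes "P \<in> triple a b u w" "Q \<in> triple a b u w" "P \<noteq> Q"
    "P \<in> triple a' b' u' w'" "Q \<in> triple a' b' u' w'"
  shows "a = a' \<and> b = b' \<and> u = u' \<and> w = w'"
proof -
  obtain i s x y where P: "P = (i, s, x, y)" by (cases P)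
  obtain j s' x' y' where Q: "Q = (j, s', x', y')" by (cases Q)
  have "i \<noteq> j" using assms(1-3) by (auto simp: triple_def P Q)
  then have "a = a' \<and> b = b'"
    using triple_mem_cases[OF assms(1)[unfolded P]] triple_mem_cases[OF assms(4)[unfolded P]]
      triple_mem_cases[OF assms(2)[unfolded Q]] triple_mem_cases[OF assms(5)[unfolded Q]]
    by (elim disjE conjE; simp)
  then show ?thesis using assms(1,4) unfolding triple_def P by auto
qed

text \<open>The zero sum fixes the \<open>s\<close>-coordinate in class \<open>k\<close>, and
  adjacency to the class \<open>j\<close> vertex fixes the rest, so only the vertex that the
  hyperedge already has in class \<open>k\<close> is possible.\<close>

lemma triple_third:
  assumes "(i, s, p) \<in> triple a b u w" "(j, s', p') \<in> triple a b u w" "i \<noteq> j"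
    "adj (j, s', p') (k, r, q)" "k \<noteq> i" "s + s' + r = 0"
  shows "(k, r, q) \<in> triple a b u w"
proof -
  obtain x y where q: "q = (x, y)" by (cases q)
  obtain x' y' where p': "p' = (x', y')" by (cases p')
  have "k < 3" "k \<noteq> j" using assms(4) by (simp_all add: q p' adj_iff)
  then have "\<exists>r' x'' y''. (k, r', x'', y'') \<in> triple a b u w"
    using less_3_cases[of k] unfolding triple_def by blast
  then obtain r' x'' y'' where R: "(k, r', x'', y'') \<in> triple a b u w" by blast
  have "s + s' + r' = 0"
    using triple_mem_cases[OF assms(1)] triple_mem_cases[OF assms(2)] triple_mem_cases[OF R]
      assms(3,5) \<open>k \<noteq> j\<close>
    by (elim disjE conjE; simp)
  then have r: "r' = r" using assms(6) by (metis add_left_cancel)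
  have "adj (j, s', p') (k, r', x'', y'')"
    using triple_adj[OF assms(2) R] \<open>k \<noteq> j\<close> by simp
  then have "x' - x'' = x' - x" "y' - y'' = y' - y"
    using assms(4) by (simp_all only: q p' r adj_iff)
  then show ?thesis using R by (simp add: q r)
qed

text \<open>By \<open>triple_third\<close>, the last condition says that \<open>v2\<close> is not the third vertex of the hyperedge
  through \<open>x\<close> and \<open>v1\<close>.\<close>

definition good_path :: "'a::field vertex \<Rightarrow> 'a vertex \<Rightarrow> 'a vertex \<Rightarrow> 'a vertex \<Rightarrow> bool" where
  "good_path x v1 v2 y \<longleftrightarrow> adj x v1 \<and> adj v1 v2 \<and> adj v2 y \<and> x \<noteq> v2 \<and> v1 \<noteq> y \<and>
     (fst x \<noteq> fst v2 \<longrightarrow> fst (snd x) + fst (snd v1) + fst (snd v2) \<noteq> 0)"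

text \<open>There are \<open>3 * 3\<close> choices of inner classes, each with at most five pairs of
  \<open>s\<close>-coordinates. These determine the path, as the adjacency equations yield the other
  coordinates step by step from \<open>x\<close>; their sum telescopes to the system of
  \<open>card_paths_le\<close>.\<close>

lemma card_good_paths:
  fixes x y :: "'a::field vertex"
  assumes two: "(2::'a) \<noteq> 0" and three: "(3::'a) \<noteq> 0"
  shows "finite {(v1, v2). good_path x v1 v2 y} \<and> card {(v1, v2). good_path x v1 v2 y} \<le> 45"
proof -
  obtain i a ux wx where x: "x = (i, a, ux, wx)" by (cases x)
  obtain l d uy wy where y: "y = (l, d, uy, wy)" by (cases y)
  define S where "S = (\<lambda>(j, k). {(b, c).
      orient i j * qform a b + orient j k * qform b c + orient k l * qform c d = ux - uy \<and>
      orient i j * cform a b + orient j k * cform b c + orient k l * cform c d = wx - wy \<and>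
      ((orient i j :: 'a) = orient j k \<longrightarrow> a + b + c \<noteq> 0) \<and> ((orient i j :: 'a) \<noteq> orient j k \<longrightarrow> a \<noteq> c) \<and>
      ((orient j k :: 'a) \<noteq> orient k l \<longrightarrow> b \<noteq> d)})"
  have S: "finite (S z) \<and> card (S z) \<le> 5" for z
  proof (cases z)
    case (Pair j k)
    show ?thesis
      unfolding S_def Pair prod.case by (rule card_paths_le[OF two three orient_in orient_in orient_in])
  qed
  let ?I = "{0..<3::nat} \<times> {0..<3::nat}"
  let ?G = "{(v1, v2). good_path x v1 v2 y}"
  let ?h = "\<lambda>(v1 :: 'a vertex, v2 :: 'a vertex). ((fst v1, fst v2), (fst (snd v1), fst (snd v2)))"
  have finI: "finite (SIGMA z:?I. S z)" using S by auto
  have "card (SIGMA z:?I. S z) = (\<Sum>z\<in>?I. card (S z))" using S by simp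
  also have "\<dots> \<le> (\<Sum>z\<in>?I. 5)" using S by (intro sum_mono) blast
  also have "\<dots> = 45" by simp
  finally have cardI: "card (SIGMA z:?I. S z) \<le> 45" .
  have inj: "inj_on ?h ?G"
  proof (rule inj_onI)
    fix g g' assume g: "g \<in> ?G" "g' \<in> ?G" and eq: "?h g = ?h g'"
    obtain j b u1 w1 k c u2 w2 where g1: "g = ((j, b, u1, w1), (k, c, u2, w2))"
      by (metis surj_pair)
    obtain j' b' u1' w1' k' c' u2' w2' where "g' = ((j', b', u1', w1'), (k', c', u2', w2'))"
      by (metis surj_pair)
    with eq have g2: "g' = ((j, b, u1', w1'), (k, c, u2', w2'))" by (simp add: g1)
    have "ux - u1 = ux - u1'" "wx - w1 = wx - w1'" "u1 - u2 = u1' - u2'" "w1 - w2 = w1' - w2'"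
      using g unfolding g1 g2 x by (simp_all add: good_path_def adj_iff)
    then show "g = g'" by (simp add: g1 g2)
  qed
  have sub: "?h ` ?G \<subseteq> (SIGMA z:?I. S z)"
  proof (rule image_subsetI)
    fix g assume g: "g \<in> ?G"
    obtain j b u1 w1 k c u2 w2 where g1: "g = ((j, b, u1, w1), (k, c, u2, w2))"
      by (metis surj_pair)
    have gp: "good_path x (j, b, u1, w1) (k, c, u2, w2) y" using g by (simp add: g1)
    then have lt: "i < 3" "j < 3" "k < 3" "l < 3" and ne: "i \<noteq> j" "j \<noteq> k" "k \<noteq> l"
      and e1: "ux - u1 = orient i j * qform a b" "wx - w1 = orient i j * cform a b"
      and e2: "u1 - u2 = orient j k * qform b c" "w1 - w2 = orient j k * cform b c"
      and e3: "u2 - uy = orient k l * qform c d" "w2 - wy = orient k l * cform c d"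
      and nd: "(i, a, ux, wx) \<noteq> (k, c, u2, w2)" "(j, b, u1, w1) \<noteq> (l, d, uy, wy)"
        "i \<noteq> k \<longrightarrow> a + b + c \<noteq> 0"
      by (simp_all add: good_path_def x y adj_iff)
    have "orient i j * qform a b + orient j k * qform b c + orient k l * qform c d = ux - uy"
      "orient i j * cform a b + orient j k * cform b c + orient k l * cform c d = wx - wy"
      unfolding e1[symmetric] e2[symmetric] e3[symmetric] by simp_all
    moreover have "(orient i j :: 'a) = orient j k \<longrightarrow> a + b + c \<noteq> 0"
      using nd(3) orient_turn[OF two lt(1-3) ne(1,2)] by blast
    \<comment> \<open>Returning to class \<open>i\<close> with \<open>a = c\<close> would undo the
      first step and reach \<open>x\<close> again. The case \<open>b = d\<close> is the same at the
      other end.\<close>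
    moreover have "a \<noteq> c" if "(orient i j :: 'a) \<noteq> orient j k"
    proof
      assume "a = c"
      have ki: "k = i" using that orient_turn[OF two lt(1-3) ne(1,2)] by blast
      have "ux - u1 = - (u1 - u2)" "wx - w1 = - (w1 - w2)"
        using e1 e2 orient_swap[OF lt(1,2) ne(1), where 'a = 'a] \<open>a = c\<close> ki qform_commute cform_commute
        by (metis minus_mult_left minus_minus)+
      then have "ux = u2" "wx = w2" by simp_all
      then show False using nd(1) \<open>a = c\<close> ki by simp
    qed
    moreover have "b \<noteq> d" if "(orient j k :: 'a) \<noteq> orient k l"
    proof
      assume "b = d"
      have lj: "l = j" using that orient_turn[OF two lt(2-4) ne(2,3)] by blast
      have "u1 - u2 = - (u2 - uy)" "w1 - w2 = - (w2 - wy)"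
        using e2 e3 orient_swap[OF lt(2,3) ne(2), where 'a = 'a] \<open>b = d\<close> lj qform_commute cform_commute
        by (metis minus_mult_left minus_minus)+
      then have "u1 = uy" "w1 = wy" by simp_all
      then show False using nd(2) \<open>b = d\<close> lj by simp
    qed
    ultimately show "?h g \<in> (SIGMA z:?I. S z)"
      using lt by (simp add: g1 S_def)
  qed
  have "finite ?G" using inj sub finI by (meson finite_imageD finite_subset)
  moreover have "card ?G \<le> 45"
    using card_inj_on_le[OF inj sub finI] cardI by linarith
  ultimately show ?thesis by blast
qed

section \<open>The hypergraph over a finite subring\<close>

definition theta_free_hypergraph :: "'a::field set \<Rightarrow> 'a vertex hypergraph" where
  "theta_free_hypergraph K = ({0..<3} \<times> K \<times> K \<times> K,
     (\<lambda>(a, b, u, w). triple a b u w) ` (K \<times> K \<times> K \<times> K))"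

lemma theta_free_hypergraph_linear: "linear_hypergraph (theta_free_hypergraph K)"
  unfolding linear_hypergraph_def
proof (intro ballI impI)
  fix e f assume ef: "e \<in> hedges (theta_free_hypergraph K)" "f \<in> hedges (theta_free_hypergraph K)" "e \<noteq> f"
  obtain a b u w a' b' u' w' where e: "e = triple a b u w" and f: "f = triple a' b' u' w'"
    using ef(1,2) unfolding theta_free_hypergraph_def by auto
  have "P = Q" if "P \<in> e \<inter> f" "Q \<in> e \<inter> f" for P Q
    using triple_unique[of P a b u w Q a' b' u' w'] that ef(3) unfolding e f by blast
  moreover have "finite (e \<inter> f)" unfolding e triple_def by blast
  ultimately have "card (e \<inter> f) \<le> Suc 0" using card_le_Suc0_iff_eq by blast
  then show "card (e \<inter> f) \<le> 1" by simp
qed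

text \<open>Each path of a copy is good, and distinct paths have distinct first inner vertices, so
  there are at most 45.\<close>

lemma theta_free_hypergraph_no_copy:
  fixes K :: "'a::field set"
  assumes two: "(2::'a) \<noteq> 0" and three: "(3::'a) \<noteq> 0" and t: "45 < t" and F: "F \<in> berge_theta3 t"
  shows "\<not> contains_copy (theta_free_hypergraph K) F"
proof
  let ?G = "theta_free_hypergraph K"
  assume "contains_copy ?G F"
  then obtain f where f: "inj_on f (hverts F)" "\<forall>e\<in>hedges F. f ` e \<in> hedges ?G"
    unfolding contains_copy_def by blast
  obtain x y :: nat and v :: "nat \<Rightarrow> nat \<Rightarrow> nat" and e :: "nat \<Rightarrow> nat \<Rightarrow> nat set"
    where vF: "hverts F = \<Union>(hedges F)" and "x \<noteq> y"
    and vinj: "inj_on (\<lambda>(i, j). v i j) ({1..t} \<times> {1, 2::nat})"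
    and vxy: "\<forall>i\<in>{1..t}. \<forall>j\<in>{1, 2}. v i j \<noteq> x \<and> v i j \<noteq> y"
    and einj: "inj_on (\<lambda>(i, j). e i j) ({1..t} \<times> {1, 2, 3::nat})"
    and eF: "hedges F = (\<lambda>(i, j). e i j) ` ({1..t} \<times> {1, 2, 3})"
    and inc: "\<forall>i\<in>{1..t}. {x, v i 1} \<subseteq> e i 1 \<and> {v i 1, v i 2} \<subseteq> e i 2 \<and> {v i 2, y} \<subseteq> e i 3"
    using F unfolding berge_theta3_def mem_Collect_eq
    by (elim conjE exE) (rule that, assumption+)
  let ?Z = "{(v1, v2). good_path (f x) v1 v2 (f y)}"
  have "(f (v i 1), f (v i 2)) \<in> ?Z" if i: "i \<in> {1..t}" for i
  proof -
    have eh: "e i j \<in> hedges F" if "j \<in> {1, 2, 3}" for j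
      using i that unfolding eF by (intro image_eqI[of _ _ "(i, j)"]) simp_all
    have mem: "x \<in> e i 1" "v i 1 \<in> e i 1" "v i 1 \<in> e i 2" "v i 2 \<in> e i 2" "v i 2 \<in> e i 3" "y \<in> e i 3"
      using inc i by simp_all
    have sub: "e i j \<subseteq> hverts F" if "j \<in> {1, 2, 3}" for j using eh[OF that] vF by blast
    have inV: "x \<in> hverts F" "y \<in> hverts F" "v i 1 \<in> hverts F" "v i 2 \<in> hverts F"
      using mem sub[of 1] sub[of 2] sub[of 3] by auto
    have "v i 1 \<noteq> v i 2" using inj_onD[OF vinj, of "(i, 1)" "(i, 2)"] i by auto
    moreover have "e i 1 \<noteq> e i 2" using inj_onD[OF einj, of "(i, 1)" "(i, 2)"] i by auto
    moreover have "v i j \<noteq> x" "v i j \<noteq> y" if "j \<in> {1, 2}" for j using vxy i that by blast+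
    ultimately have ne: "f x \<noteq> f (v i 1)" "f (v i 1) \<noteq> f (v i 2)" "f (v i 2) \<noteq> f y"
      "f x \<noteq> f (v i 2)" "f (v i 1) \<noteq> f y"
      and nee: "f ` e i 1 \<noteq> f ` e i 2"
      using f(1) inV sub[of 1] sub[of 2] by (auto simp: inj_on_eq_iff inj_on_image_eq_iff)
    obtain a b u w where E1: "f ` e i 1 = triple a b u w"
      using f(2) eh[of 1] unfolding theta_free_hypergraph_def by auto
    obtain a' b' u' w' where E2: "f ` e i 2 = triple a' b' u' w'"
      using f(2) eh[of 2] unfolding theta_free_hypergraph_def by auto
    obtain a'' b'' u'' w'' where E3: "f ` e i 3 = triple a'' b'' u'' w''"
      using f(2) eh[of 3] unfolding theta_free_hypergraph_def by auto
    have T: "f x \<in> triple a b u w" "f (v i 1) \<in> triple a b u w"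
      "f (v i 1) \<in> triple a' b' u' w'" "f (v i 2) \<in> triple a' b' u' w'"
      "f (v i 2) \<in> triple a'' b'' u'' w''" "f y \<in> triple a'' b'' u'' w''"
      using mem unfolding E1[symmetric] E2[symmetric] E3[symmetric] by auto
    have A: "adj (f x) (f (v i 1))" "adj (f (v i 1)) (f (v i 2))" "adj (f (v i 2)) (f y)"
      using triple_adj T ne by blast+
    \<comment> \<open>With zero sum, the image of \<open>v i 2\<close> would be the third vertex of
      the first hyperedge, so the images of \<open>e i 1\<close> and \<open>e i 2\<close> would
      share two vertices and coincide.\<close>
    have "fst (snd (f x)) + fst (snd (f (v i 1))) + fst (snd (f (v i 2))) \<noteq> 0"
      if "fst (f x) \<noteq> fst (f (v i 2))"
    proof
      assume z: "fst (snd (f x)) + fst (snd (f (v i 1))) + fst (snd (f (v i 2))) = 0"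
      obtain i0 s p j s' p' k r q where X: "f x = (i0, s, p)" "f (v i 1) = (j, s', p')"
        "f (v i 2) = (k, r, q)" by (metis prod.collapse)
      have "i0 \<noteq> j" using A(1) unfolding X by (cases p, cases p') (simp add: adj_iff)
      then have "f (v i 2) \<in> triple a b u w"
        using triple_third[of i0 s p a b u w j s' p' k r q] T A(2) z that unfolding X by auto
      then have "triple a b u w = triple a' b' u' w'"
        using triple_unique[OF T(2) _ ne(2) T(3,4)] by blast
      then show False using nee E1 E2 by simp
    qed
    then show ?thesis using A ne by (simp add: good_path_def)
  qed
  then have sub: "(\<lambda>i. (f (v i 1), f (v i 2))) ` {1..t} \<subseteq> ?Z" by blast
  have "inj_on (\<lambda>i. (f (v i 1), f (v i 2))) {1..t}"
  proof (rule inj_onI)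
    fix i k assume ik: "i \<in> {1..t}" "k \<in> {1..t}" and eq: "(f (v i 1), f (v i 2)) = (f (v k 1), f (v k 2))"
    have "v i 1 \<in> hverts F" if "i \<in> {1..t}" for i
      using inc that unfolding vF eF by force
    then have "v i 1 = v k 1" using eq f(1) ik by (auto dest: inj_onD)
    then show "i = k" using inj_onD[OF vinj, of "(i, 1)" "(k, 1)"] ik by auto
  qed
  then have "card {1..t} \<le> card ?Z"
    using sub card_good_paths[OF two three, of "f x" "f y"] by (intro card_inj_on_le) auto
  then show False using t card_good_paths[OF two three, of "f x" "f y"] by simp
qed

lemma theta_free_hypergraph_sizes:
  fixes K :: "'a::field set"
  assumes fin: "finite K"
    and plus: "\<And>x y. x \<in> K \<Longrightarrow> y \<in> K \<Longrightarrow> x + y \<in> K" and neg: "\<And>x. x \<in> K \<Longrightarrow> - x \<in> K"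
    and mult: "\<And>x y. x \<in> K \<Longrightarrow> y \<in> K \<Longrightarrow> x * y \<in> K" and one: "1 \<in> K"
  shows "uniform3 (theta_free_hypergraph K)"
    and "card (hverts (theta_free_hypergraph K)) = 3 * card K ^ 3"
    and "card (hedges (theta_free_hypergraph K)) = card K ^ 4"
proof -
  have diff: "x - y \<in> K" if "x \<in> K" "y \<in> K" for x y
    using plus[OF that(1) neg[OF that(2)]] by simp
  have "numeral m \<in> K" for m
    by (induction m) (simp_all only: numeral.simps plus one)
  then have f: "qform x y \<in> K" "cform x y \<in> K" if "x \<in> K" "y \<in> K" for x y
    using that unfolding qform_def cform_def power2_eq_square power3_eq_cube
    by (intro plus mult; simp)+
  have tr: "triple a b u w \<subseteq> {0..<3} \<times> K \<times> K \<times> K \<and> card (triple a b u w) = 3"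
    if "a \<in> K" "b \<in> K" "u \<in> K" "w \<in> K" for a b u w
    using that by (auto simp: triple_def intro!: plus diff neg f)
  then show "uniform3 (theta_free_hypergraph K)"
    using fin unfolding uniform3_def theta_free_hypergraph_def by auto
  show "card (hverts (theta_free_hypergraph K)) = 3 * card K ^ 3"
    by (simp add: theta_free_hypergraph_def card_cartesian_product power3_eq_cube)
  have "inj_on (\<lambda>(a, b, u, w). triple a b u w) (K \<times> K \<times> K \<times> K)"
  proof (rule inj_onI)
    fix p r assume eq: "(case p of (a, b, u, w) \<Rightarrow> triple a b u w) =
      (case r of (a, b, u, w) \<Rightarrow> triple a b u w)"
    obtain a b u w a' b' u' w' where p: "p = (a, b, u, w)" and r: "r = (a', b', u', w')"
      by (metis surj_pair)
    have "(0, a, u, w) \<in> triple a b u w" "(1, b, u - qform a b, w - cform a b) \<in> triple a b u w"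
      by (simp_all add: triple_def)
    then show "p = r"
      using triple_unique[of "(0, a, u, w)" a b u w "(1, b, u - qform a b, w - cform a b)" a' b' u' w'] eq
      unfolding p r by auto
  qed
  then show "card (hedges (theta_free_hypergraph K)) = card K ^ 4"
    by (simp add: theta_free_hypergraph_def card_image card_cartesian_product power4_eq_xxxx mult.assoc)
qed

text \<open>Vertices are relabelled by numbers and padded with isolated ones up to \<open>n\<close>.
  Since every vertex of \<open>F\<close> lies in a hyperedge, a copy avoids the padding and pulls
  back to \<open>G\<close>.\<close>

lemma card_hedges_in_ex_lin3_sizes:
  fixes G :: "'a hypergraph" and \<F> :: "'b hypergraph set"
  assumes G: "uniform3 G" "linear_hypergraph G" and n: "card (hverts G) \<le> n"
    and free: "\<And>F. F \<in> \<F> \<Longrightarrow> hverts F = \<Union>(hedges F) \<and> \<not> contains_copy G F"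
  shows "card (hedges G) \<in> ex_lin3_sizes n \<F>"
proof -
  have finV: "finite (hverts G)" and sub: "\<And>e. e \<in> hedges G \<Longrightarrow> e \<subseteq> hverts G"
    using G(1) by (auto simp: uniform3_def)
  obtain \<phi> :: "'a \<Rightarrow> nat" where \<phi>: "bij_betw \<phi> (hverts G) {0..<card (hverts G)}"
    using ex_bij_betw_finite_nat[OF finV] by blast
  then have inj: "inj_on \<phi> (hverts G)" and im: "\<phi> ` hverts G \<subseteq> {..<n}"
    using n by (auto simp: bij_betw_def)
  define H where "H = ({..<n}, (`) \<phi> ` hedges G)"
  have inj_e: "inj_on ((`) \<phi>) (hedges G)"
    using inj sub by (meson inj_on_image inj_on_subset inj_on_image_Pow PowI subsetI)
  have "uniform3 H"
    unfolding uniform3_def H_def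
  proof (clarsimp, intro conjI)
    fix e assume e: "e \<in> hedges G"
    then show "\<phi> ` e \<subseteq> {..<n}" using sub im by blast
    show "card (\<phi> ` e) = 3"
      using e G(1) inj sub by (simp add: card_image inj_on_subset uniform3_def)
  qed
  moreover have "linear_hypergraph H"
    unfolding linear_hypergraph_def H_def
  proof clarsimp
    fix e f assume ef: "e \<in> hedges G" "f \<in> hedges G" "\<phi> ` e \<noteq> \<phi> ` f"
    then have "\<phi> ` e \<inter> \<phi> ` f = \<phi> ` (e \<inter> f)"
      using inj_on_image_Int[OF inj] sub by blast
    moreover have "card (\<phi> ` (e \<inter> f)) \<le> card (e \<inter> f)"
      using finite_subset[OF sub[OF ef(1)] finV] by (intro card_image_le) simp
    moreover have "card (e \<inter> f) \<le> 1" using ef G(2) unfolding linear_hypergraph_def by blast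
    ultimately show "card (\<phi> ` e \<inter> \<phi> ` f) \<le> Suc 0" by simp
  qed
  moreover have "\<not> contains_copy H F" if F: "F \<in> \<F>" for F
  proof
    assume "contains_copy H F"
    then obtain f where f: "inj_on f (hverts F)" "\<And>e. e \<in> hedges F \<Longrightarrow> f ` e \<in> hedges H"
      unfolding contains_copy_def by blast
    define g where "g = inv_into (hverts G) \<phi> \<circ> f"
    have ge: "g ` e \<in> hedges G" and fe: "f ` e \<subseteq> \<phi> ` hverts G" if e: "e \<in> hedges F" for e
    proof -
      obtain e' where e': "e' \<in> hedges G" "f ` e = \<phi> ` e'" using f(2)[OF e] by (auto simp: H_def)
      then have "g ` e = e'"
        unfolding g_def image_comp[symmetric] using inj sub by (simp add: inv_into_image_cancel)
      then show "g ` e \<in> hedges G" using e' by simp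
      show "f ` e \<subseteq> \<phi> ` hverts G" using e' sub by (metis image_mono)
    qed
    have vF: "hverts F = \<Union>(hedges F)" using free[OF F] by blast
    have "f ` hverts F \<subseteq> \<phi> ` hverts G" using fe unfolding vF by blast
    then have "inj_on g (hverts F)"
      unfolding g_def using f(1) by (intro comp_inj_on inj_on_inv_into)
    moreover have "g ` hverts F \<subseteq> hverts G" using ge sub unfolding vF by blast
    ultimately have "contains_copy G F" unfolding contains_copy_def using ge by blast
    then show False using free[OF F] by blast
  qed
  moreover have "card (hedges H) = card (hedges G)" "card (hverts H) = n"
    using inj_e by (simp_all add: H_def card_image)
  ultimately show ?thesis
    unfolding ex_lin3_sizes_def mem_Collect_eq by (intro exI[of _ H]) simp
qed

section \<open>The lower bound for all large \<open>n\<close>\<close>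

lemma pow4_le_ex_lin3:
  fixes K :: "'a::field set"
  assumes K: "finite K" "\<And>x y. x \<in> K \<Longrightarrow> y \<in> K \<Longrightarrow> x + y \<in> K" "\<And>x. x \<in> K \<Longrightarrow> - x \<in> K"
      "\<And>x y. x \<in> K \<Longrightarrow> y \<in> K \<Longrightarrow> x * y \<in> K" "1 \<in> K"
    and char: "(2::'a) \<noteq> 0" "(3::'a) \<noteq> 0" and t: "45 < t" and n: "3 * card K ^ 3 \<le> n"
  shows "card K ^ 4 \<le> ex_lin3 n (berge_theta3 t)"
proof -
  have "card (hedges (theta_free_hypergraph K)) \<in> ex_lin3_sizes n (berge_theta3 t)"
  proof (rule card_hedges_in_ex_lin3_sizes)
    show "hverts F = \<Union>(hedges F) \<and> \<not> contains_copy (theta_free_hypergraph K) F"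
      if F: "F \<in> berge_theta3 t" for F
    proof
      show "hverts F = \<Union>(hedges F)"
        using F unfolding berge_theta3_def mem_Collect_eq by (elim conjE)
      show "\<not> contains_copy (theta_free_hypergraph K) F"
        using theta_free_hypergraph_no_copy[OF char t F] .
    qed
  qed (use theta_free_hypergraph_sizes[OF K] theta_free_hypergraph_linear n in auto)
  then show ?thesis
    unfolding ex_lin3_def using theta_free_hypergraph_sizes(3)[OF K] finite_ex_lin3_sizes
    by (metis Max_ge)
qed

text \<open>The largest \<open>k\<close> with \<open>3 * (5^k)^3 \<le> n\<close> works: failure of
  \<open>k + 1\<close> gives the factor \<open>375 = 3 * 5^3\<close>, and \<open>375 \<le> n\<close>
  admits \<open>k = 1\<close>.\<close>

lemma exists_power_of_five:
  fixes n :: nat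
  assumes "375 \<le> n"
  obtains k where "0 < k" "3 * (5 ^ k) ^ 3 \<le> n" "n < 375 * (5 ^ k) ^ 3"
proof -
  define k where "k = Max {k. 3 * (5 ^ k) ^ 3 \<le> n}"
  have bound: "k \<le> n" if "3 * (5 ^ k) ^ 3 \<le> n" for k :: nat
  proof -
    have "k < 5 ^ k" by (rule less_exp[THEN less_le_trans]) (simp add: power_mono)
    also have "\<dots> \<le> (5 ^ k) ^ 3" by (rule self_le_power) auto
    finally show ?thesis using that by simp
  qed
  have fin: "finite {k. 3 * (5 ^ k) ^ 3 \<le> n}"
    by (rule finite_subset[of _ "{..n}"]) (use bound in \<open>auto simp only: mem_Collect_eq atMost_iff\<close>)
  have one: "1 \<in> {k. 3 * (5 ^ k) ^ 3 \<le> n}" using assms by simp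
  have "k \<in> {k. 3 * (5 ^ k) ^ 3 \<le> n}" unfolding k_def using Max_in[OF fin] one by blast
  moreover have "1 \<le> k" unfolding k_def using fin one by (rule Max_ge)
  moreover have "Suc k \<notin> {k. 3 * (5 ^ k) ^ 3 \<le> n}"
    using Max_ge[OF fin, of "Suc k"] unfolding k_def by auto
  ultimately show ?thesis using that[of k] by (simp add: power_mult_distrib)
qed

lemma powr_four_thirds_le:
  fixes n q :: nat
  assumes "n < 375 * q ^ 3"
  shows "real n powr (4 / 3) / 375 powr (4 / 3) \<le> real (q ^ 4)"
proof -
  have "real n \<le> real (375 * q ^ 3)" using assms unfolding of_nat_le_iff by simp
  then have "real n powr (4 / 3) \<le> real (375 * q ^ 3) powr (4 / 3)"
    by (intro powr_mono2) simp_all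
  also have "\<dots> = 375 powr (4 / 3) * (real q ^ 3) powr (4 / 3)"
    by (simp add: powr_mult)
  also have "(real q ^ 3) powr (4 / 3) = real (q ^ 4)"
  proof (cases "q = 0")
    case False
    then have "(real q ^ 3) powr (4 / 3) = real q powr 4"
      by (simp add: powr_powr flip: powr_numeral)
    then show ?thesis using False by simp
  qed simp
  finally show ?thesis by (simp add: divide_le_eq mult.commute)
qed

theorem theorem1p2:
  "\<exists>c C :: real. c > 0 \<and> C > 0 \<and>
     (\<forall>\<^sub>F n in sequentially.
        c * real n powr (4 / 3) \<le> real (ex_lin3 n (berge_theta3 217)) \<and>
        real (ex_lin3 n (berge_theta3 217)) \<le> C * real n powr (4 / 3))"
proof (intro exI conjI)
  show "(0::real) < 1 / 375 powr (4 / 3)" by simp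
  show "(0::real) < 4 + 36 * real 217" by simp
  show "\<forall>\<^sub>F n in sequentially.
      1 / 375 powr (4 / 3) * real n powr (4 / 3) \<le> real (ex_lin3 n (berge_theta3 217)) \<and>
      real (ex_lin3 n (berge_theta3 217)) \<le> (4 + 36 * real 217) * real n powr (4 / 3)"
    using eventually_ge_at_top[of 375]
  proof eventually_elim
    case (elim n)
    obtain k :: nat where k: "0 < k" "3 * (5 ^ k) ^ 3 \<le> n" "n < 375 * (5 ^ k) ^ 3"
      using exists_power_of_five[OF elim] by blast
    obtain K :: "gf5_closure set" where K: "card K = 5 ^ k" "1 \<in> K"
      "\<And>x y. x \<in> K \<Longrightarrow> y \<in> K \<Longrightarrow> x + y \<in> K" "\<And>x. x \<in> K \<Longrightarrow> - x \<in> K"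
      "\<And>x y. x \<in> K \<Longrightarrow> y \<in> K \<Longrightarrow> x * y \<in> K"
      using finite_subring_gf5_closure[OF k(1)] by metis
    have "finite K" using K(1) by (intro card_ge_0_finite) simp
    then have "card K ^ 4 \<le> ex_lin3 n (berge_theta3 217)"
      using pow4_le_ex_lin3[of K 217 n] K gf5_closure_numerals k(2) by simp
    then have "real ((5 ^ k) ^ 4) \<le> real (ex_lin3 n (berge_theta3 217))"
      unfolding K(1) of_nat_le_iff .
    with powr_four_thirds_le[OF k(3)] show ?case
      using ex_lin3_berge_theta3_le[of 217 n] by simp
  qed
qed

end
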